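(* Let $G$ be a pseudo-outerplanar graph with $\Delta(G)=3$ or $\Delta(G)\geq 5$. Then $la(G)=\lceil \Delta(G)/2\rceil$.
   Context: All graphs are finite, simple and undirected. A block is a maximal 2-connected subgraph; bridges are blocks too. A graph is pseudo-outerplanar if each of its blocks can be drawn in the plane so that its vertices lie on a fixed circle, its edges lie inside the disk bounded by that circle, and each edge crosses at most one other edge. $\Delta(G)$ is the maximum degree of $G$. A linear forest is a forest each of whose components is a path. The linear arboricity $la(G)$ is the minimum $k$ such that $E(G)$ can be partitioned into $k$ sets, each inducing a linear forest. *)

theory Defs
  imports "HOL-Analysis.Analysis" "HOL-Library.Disjoint_Sets"
begin

type_synonym 'a graph = "'a set \<times> 'a set set"

abbreviation verts :: "'a graph \<Rightarrow> 'a set" where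
  "verts \<equiv> fst"

abbreviation edges :: "'a graph \<Rightarrow> 'a set set" where
  "edges \<equiv> snd"

definition simple_graph :: "'a graph \<Rightarrow> bool" where
  "simple_graph G \<longleftrightarrow> finite (verts G) \<and> (\<forall>e\<in>edges G. e \<subseteq> verts G \<and> card e = 2)"

definition subgraph :: "'a graph \<Rightarrow> 'a graph \<Rightarrow> bool" where
  "subgraph H G \<longleftrightarrow> simple_graph H \<and> verts H \<subseteq> verts G \<and> edges H \<subseteq> edges G"

definition maximal_subgraph :: "('a graph \<Rightarrow> bool) \<Rightarrow> 'a graph \<Rightarrow> 'a graph \<Rightarrow> bool" where
  "maximal_subgraph P H G \<longleftrightarrow>
     subgraph H G \<and> P H \<and> (\<forall>K. subgraph K G \<and> P K \<and> subgraph H K \<longrightarrow> K = H)"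

definition degree :: "'a graph \<Rightarrow> 'a \<Rightarrow> nat" where
  "degree G v = card {e \<in> edges G. v \<in> e}"

text \<open>The inserted 0 only matters for the graph without vertices.\<close>

definition max_degree :: "'a graph \<Rightarrow> nat" where
  "max_degree G = Max (insert 0 (degree G ` verts G))"

definition adjacency :: "'a graph \<Rightarrow> ('a \<times> 'a) set" where
  "adjacency G = {(u, v). {u, v} \<in> edges G}"

definition connected_graph :: "'a graph \<Rightarrow> bool" where
  "connected_graph G \<longleftrightarrow>
     verts G \<noteq> {} \<and> (\<forall>u\<in>verts G. \<forall>v\<in>verts G. (u, v) \<in> (adjacency G)\<^sup>*)"

definition delete_vertex :: "'a graph \<Rightarrow> 'a \<Rightarrow> 'a graph" where
  "delete_vertex G v = (verts G - {v}, {e \<in> edges G. v \<notin> e})"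

definition delete_edge :: "'a graph \<Rightarrow> 'a set \<Rightarrow> 'a graph" where
  "delete_edge G e = (verts G, edges G - {e})"

definition two_connected :: "'a graph \<Rightarrow> bool" where
  "two_connected G \<longleftrightarrow>
     3 \<le> card (verts G) \<and> connected_graph G \<and>
     (\<forall>v\<in>verts G. connected_graph (delete_vertex G v))"

definition bridge :: "'a graph \<Rightarrow> 'a set \<Rightarrow> bool" where
  "bridge G e \<longleftrightarrow>
     e \<in> edges G \<and> (\<exists>u v. e = {u, v} \<and> (u, v) \<notin> (adjacency (delete_edge G e))\<^sup>*)"

text \<open>As \<^const>\<open>two_connected\<close> requires three vertices, a bridge with its two
  ends is listed separately.\<close>

definition block :: "'a graph \<Rightarrow> 'a graph \<Rightarrow> bool" where
  "block H G \<longleftrightarrow> maximal_subgraph two_connected H G \<or> (\<exists>e. bridge G e \<and> H = (e, {e}))"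

text \<open>A drawing in the closed disk with centre \<open>c\<close> and radius \<open>r\<close>: the vertex \<open>v\<close> is
  the point \<open>p v\<close> of the bounding circle and the edge \<open>e\<close> is the simple arc \<open>\<gamma> e\<close>
  in the disk, which joins the two ends of \<open>e\<close> and meets no other vertex.\<close>

definition disk_drawing ::
  "'a graph \<Rightarrow> complex \<Rightarrow> real \<Rightarrow> ('a \<Rightarrow> complex) \<Rightarrow> ('a set \<Rightarrow> real \<Rightarrow> complex) \<Rightarrow> bool" where
  "disk_drawing G c r p \<gamma> \<longleftrightarrow>
     0 < r \<and> inj_on p (verts G) \<and> p ` verts G \<subseteq> sphere c r \<and>
     (\<forall>e\<in>edges G.
        arc (\<gamma> e) \<and> {pathstart (\<gamma> e), pathfinish (\<gamma> e)} = p ` e \<and>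
        path_image (\<gamma> e) \<subseteq> cball c r \<and> path_image (\<gamma> e) \<inter> p ` verts G = p ` e)"

text \<open>Two edges cross if their arcs share a point that is not a vertex; in particular
  touching arcs count as crossing.\<close>

definition crosses ::
  "'a graph \<Rightarrow> ('a \<Rightarrow> complex) \<Rightarrow> ('a set \<Rightarrow> real \<Rightarrow> complex) \<Rightarrow> 'a set \<Rightarrow> 'a set \<Rightarrow> bool" where
  "crosses G p \<gamma> e f \<longleftrightarrow>
     e \<noteq> f \<and> \<not> path_image (\<gamma> e) \<inter> path_image (\<gamma> f) \<subseteq> p ` verts G"

definition pseudo_outerplanar :: "'a graph \<Rightarrow> bool" where
  "pseudo_outerplanar G \<longleftrightarrow>
     (\<forall>B. block B G \<longrightarrow>
        (\<exists>c r p \<gamma>. disk_drawing B c r p \<gamma> \<and>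
           (\<forall>e\<in>edges B. card {f \<in> edges B. crosses B p \<gamma> e f} \<le> 1)))"

text \<open>A cycle is given by its vertices in cyclic order.\<close>

definition is_cycle :: "'a graph \<Rightarrow> 'a list \<Rightarrow> bool" where
  "is_cycle G xs \<longleftrightarrow>
     3 \<le> length xs \<and> distinct xs \<and> set xs \<subseteq> verts G \<and>
     (\<forall>i<length xs. {xs ! i, xs ! (Suc i mod length xs)} \<in> edges G)"

definition forest :: "'a graph \<Rightarrow> bool" where
  "forest G \<longleftrightarrow> simple_graph G \<and> (\<nexists>xs. is_cycle G xs)"

definition path_graph :: "'a graph \<Rightarrow> bool" where
  "path_graph G \<longleftrightarrow>
     (\<exists>xs. xs \<noteq> [] \<and> distinct xs \<and> verts G = set xs \<and>
        edges G = {{xs ! i, xs ! Suc i} | i. Suc i < length xs})"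

definition linear_forest :: "'a graph \<Rightarrow> bool" where
  "linear_forest G \<longleftrightarrow>
     forest G \<and> (\<forall>C. maximal_subgraph connected_graph C G \<longrightarrow> path_graph C)"

text \<open>The pair \<open>(\<Union>F, F)\<close> is the subgraph induced by the edge set \<open>F\<close>.\<close>

definition linear_arboricity :: "'a graph \<Rightarrow> nat" where
  "linear_arboricity G =
     (LEAST k. \<exists>P. partition_on (edges G) P \<and> card P = k \<and>
                   (\<forall>F\<in>P. linear_forest (\<Union>F, F)))"

end

theory Submission
  imports Defs
begin

text \<open>
  Cutting the circle open turns the drawing of a block into an arrangement of the vertices on a
  line in which every edge interleaves with at most one other edge: by the Fashoda theorem the arcs
  of two interleaving edges meet. Rotating such an arrangement brings any vertex to the front, so
  arrangements of two graphs sharing a cut vertex can be put side by side, and the whole graph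
  has such an arrangement.

  Let \<open>k = \<lceil>\<Delta>/2\<rceil>\<close> and take an edge-minimal graph with such an arrangement that is not a union of
  \<open>k\<close> linear forests. An edge \<open>uv\<close> with \<open>d(u) + d(v) \<le> 2k + 1\<close> can be coloured last, so there is none.
  Consider intervals of the line that no edge crosses; an interval containing a vertex splits
  into two such intervals at a vertex, or into three at the corners of a crossing.
  For \<open>k \<ge> 3\<close> an interval with only vertices of degree at most three inside contains at most two of
  them, each of degree two and joined to both ends. In a smallest interval with a vertex of degree
  at least four inside, some vertex \<open>a\<close> therefore has three neighbours of degree two, two of which
  have the same second neighbour \<open>u\<close>; removing the resulting four-cycle and recolouring one edge at
  \<open>a\<close> gives a colouring. For \<open>\<Delta> = 3\<close> the graph is cubic, and a smallest
  interval with a vertex inside yields two adjacent vertices with two common neighbours.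
\<close>

section \<open>Colourings with linear forests\<close>

text \<open>The thresholds come from \<open>2 * k\<close>, the number of edges that \<open>k\<close>
  linear forests can hold at a vertex. Without an edge whose ends have degree sum at most
  \<open>2 * k + 1\<close>, the sum is at most \<open>2 * k - 1\<close> and some colour has room. So
  in a minimal counterexample adjacent degrees sum to at least \<open>2 * k + 2\<close>. For
  \<open>k \<ge> 3\<close> this exceeds 3 + 3, and vertices of degree at most three are pairwise
  nonadjacent. For \<open>k = 2\<close> two vertices of degree three just meet the bound, which with
  maximum degree three forces a cubic graph. Maximum degree four gives \<open>k = 2\<close> but
  neither situation, hence the gap in the hypothesis.

  A four-cycle through two vertices of degree two resists colouring only if its other two corners
  have the same single colour to spare: all four edges would need it. The third neighbour of degree
  two is there to escape from this case.

  Of a drawing only one implication is kept: interleaving edges cross. Arcs may also meet without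
  interleaving ends, but only an upper bound on interleaving partners has to be transferred.\<close>

abbreviation deg :: "'a set set \<Rightarrow> 'a \<Rightarrow> nat" where
  "deg E v \<equiv> card {e \<in> E. v \<in> e}"

text \<open>All extensions and recolourings below are made of this one step, in which \<open>u\<close> is a new leaf or
  a new component; no argument about cycles is needed.\<close>

inductive path_forest :: "'a set set \<Rightarrow> bool" where
  empty: "path_forest {}"
| attach: "\<lbrakk>path_forest F; u \<noteq> v; u \<notin> \<Union>F; deg F v \<le> 1\<rbrakk> \<Longrightarrow> path_forest (insert {u, v} F)"

lemma path_forest_finite: "path_forest F \<Longrightarrow> finite F"
  by (induction rule: path_forest.induct) auto

lemma deg_insert:
  "finite E \<Longrightarrow> e \<notin> E \<Longrightarrow> deg (insert e E) v = deg E v + (if v \<in> e then 1 else 0)"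
proof -
  assume "finite E" "e \<notin> E"
  moreover have "{f \<in> insert e E. v \<in> f} = (if v \<in> e then insert e {f \<in> E. v \<in> f} else {f \<in> E. v \<in> f})"
    by auto
  ultimately show ?thesis by simp
qed

lemma deg_eq_0_iff: "finite E \<Longrightarrow> deg E v = 0 \<longleftrightarrow> v \<notin> \<Union>E"
  by auto

lemma path_forest_deg: "path_forest F \<Longrightarrow> deg F w \<le> 2"
proof (induction arbitrary: w rule: path_forest.induct)
  case (attach F u v)
  have fin: "finite F" using attach.hyps path_forest_finite by blast
  have new: "{u, v} \<notin> F" using attach.hyps by blast
  have "deg F u = 0" using fin attach.hyps by (simp add: deg_eq_0_iff)
  then show ?case using deg_insert[OF fin new, of w] attach by (auto split: if_splits)
qed simp

text \<open>Dropping edges from a construction leaves a construction: \<open>u\<close> stays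
  uncovered and the degree of \<open>v\<close> does not grow, so every surviving edge can still be
  attached.\<close>

lemma path_forest_subset: "path_forest F \<Longrightarrow> F' \<subseteq> F \<Longrightarrow> path_forest F'"
proof (induction arbitrary: F' rule: path_forest.induct)
  case empty
  then show ?case by (auto intro: path_forest.empty)
next
  case (attach F u v)
  have fin: "finite F" using attach.hyps path_forest_finite by blast
  have sub: "F' - {{u, v}} \<subseteq> F" using attach.prems by auto
  have IH: "path_forest (F' - {{u, v}})" by (rule attach.IH[OF sub])
  show ?case
  proof (cases "{u, v} \<in> F'")
    case True
    have "deg (F' - {{u, v}}) v \<le> deg F v"
      using sub fin by (intro card_mono) auto
    then have "path_forest (insert {u, v} (F' - {{u, v}}))"
      using IH attach.hyps sub by (intro path_forest.attach) auto
    then show ?thesis using True by (simp add: insert_absorb)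
  next
    case False
    then show ?thesis using IH by simp
  qed
qed

section \<open>Colour degrees and extension of a colouring by single edges\<close>

definition linear_coloring :: "nat \<Rightarrow> 'a set set \<Rightarrow> ('a set \<Rightarrow> nat) \<Rightarrow> bool" where
  "linear_coloring k E \<phi> \<longleftrightarrow>
     finite E \<and> (\<forall>e\<in>E. \<phi> e < k) \<and> (\<forall>c. path_forest {e \<in> E. \<phi> e = c})"

definition linear_colorable :: "nat \<Rightarrow> 'a set set \<Rightarrow> bool" where
  "linear_colorable k E \<longleftrightarrow> (\<exists>\<phi>. linear_coloring k E \<phi>)"

definition cdeg :: "'a set set \<Rightarrow> ('a set \<Rightarrow> nat) \<Rightarrow> nat \<Rightarrow> 'a \<Rightarrow> nat" where
  "cdeg E \<phi> c v = deg {e \<in> E. \<phi> e = c} v"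

lemma linear_coloring_finite: "linear_coloring k E \<phi> \<Longrightarrow> finite E"
  by (simp add: linear_coloring_def)

lemma cdeg_le_2: "linear_coloring k E \<phi> \<Longrightarrow> cdeg E \<phi> c v \<le> 2"
  by (simp only: cdeg_def linear_coloring_def path_forest_deg)

lemma cdeg_notin: "v \<notin> \<Union>E \<Longrightarrow> cdeg E \<phi> c v = 0"
  unfolding cdeg_def by (auto simp: card_eq_0_iff)

lemma cdeg_insert:
  assumes "finite E" "e \<notin> E"
  shows "cdeg (insert e E) (\<phi>(e := c)) d v = cdeg E \<phi> d v + (if d = c \<and> v \<in> e then 1 else 0)"
proof (cases "d = c")
  case True
  have "{f \<in> insert e E. (\<phi>(e := c)) f = d} = insert e {f \<in> E. \<phi> f = d}"
    using assms True by auto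
  moreover have "deg (insert e {f \<in> E. \<phi> f = d}) v = deg {f \<in> E. \<phi> f = d} v + (if v \<in> e then 1 else 0)"
    using assms by (intro deg_insert) simp_all
  ultimately show ?thesis using True unfolding cdeg_def by simp
next
  case False
  have "{f \<in> insert e E. (\<phi>(e := c)) f = d} = {f \<in> E. \<phi> f = d}"
    using assms False by auto
  then show ?thesis using False unfolding cdeg_def by simp
qed

lemma sum_cdeg:
  assumes "linear_coloring k E \<phi>"
  shows "(\<Sum>c<k. cdeg E \<phi> c v) = deg E v"
proof -
  have "{e \<in> E. v \<in> e} = (\<Union>c<k. {e \<in> {e \<in> E. \<phi> e = c}. v \<in> e})"
    using assms by (auto simp: linear_coloring_def)
  then have "deg E v = card (\<Union>c<k. {e \<in> {e \<in> E. \<phi> e = c}. v \<in> e})" by simp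
  also have "\<dots> = (\<Sum>c<k. cdeg E \<phi> c v)"
    unfolding cdeg_def using assms
    by (intro card_UN_disjoint) (auto simp: linear_coloring_def)
  finally show ?thesis by simp
qed

lemma linear_coloring_subset:
  assumes "linear_coloring k E \<phi>" "F \<subseteq> E"
  shows "linear_coloring k F \<phi>"
proof -
  have "path_forest {e \<in> F. \<phi> e = c}" for c
  proof (rule path_forest_subset)
    show "path_forest {e \<in> E. \<phi> e = c}" using assms by (simp add: linear_coloring_def)
    show "{e \<in> F. \<phi> e = c} \<subseteq> {e \<in> E. \<phi> e = c}" using assms by blast
  qed
  moreover have "finite F" using assms finite_subset unfolding linear_coloring_def by blast
  ultimately show ?thesis using assms by (auto simp: linear_coloring_def)
qed

text \<open>The \<open>attach\<close> step inside one colour class. The two ends play different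
  roles: \<open>u\<close> must be new to the colour, while \<open>v\<close> may already be the end
  of a path of that colour.\<close>

lemma linear_coloring_extend:
  assumes "linear_coloring k E \<phi>" "{u, v} \<notin> E" "u \<noteq> v" "c < k"
    and "cdeg E \<phi> c u = 0" "cdeg E \<phi> c v \<le> 1"
  shows "linear_coloring k (insert {u, v} E) (\<phi>({u, v} := c))"
proof -
  have fin: "finite E" using assms(1) by (rule linear_coloring_finite)
  have "path_forest {e \<in> insert {u, v} E. (\<phi>({u, v} := c)) e = d}" for d
  proof (cases "d = c")
    case True
    have "{e \<in> insert {u, v} E. (\<phi>({u, v} := c)) e = d} = insert {u, v} {e \<in> E. \<phi> e = c}"
      using assms(2) True by auto
    moreover have "path_forest (insert {u, v} {e \<in> E. \<phi> e = c})"
    proof (rule path_forest.attach)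
      show "path_forest {e \<in> E. \<phi> e = c}" using assms(1) by (simp add: linear_coloring_def)
      have "deg {e \<in> E. \<phi> e = c} u = 0" using assms(5) unfolding cdeg_def .
      then show "u \<notin> \<Union>{e \<in> E. \<phi> e = c}" using fin by auto
      show "deg {e \<in> E. \<phi> e = c} v \<le> 1" using assms(6) unfolding cdeg_def .
    qed fact
    ultimately show ?thesis by simp
  next
    case False
    then have "{e \<in> insert {u, v} E. (\<phi>({u, v} := c)) e = d} = {e \<in> E. \<phi> e = d}"
      using assms(2) by auto
    then show ?thesis using assms(1) by (simp add: linear_coloring_def)
  qed
  then show ?thesis using assms(1,4) by (auto simp: linear_coloring_def)
qed

text \<open>Without the edge its ends have degree sum below \<open>2 * k\<close>, so some colour
  occurs at most once at both ends together. It is then absent at one end and occurs at most once at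
  the other.\<close>

lemma light_edge_reducible:
  assumes "linear_colorable k (E - {{u, v}})" "finite E" "{u, v} \<in> E" "u \<noteq> v"
    and "deg E u + deg E v \<le> 2 * k + 1"
  shows "linear_colorable k E"
proof -
  let ?E = "E - {{u, v}}"
  obtain \<phi> where \<phi>: "linear_coloring k ?E \<phi>" using assms(1) unfolding linear_colorable_def by blast
  have E: "insert {u, v} ?E = E" using assms(3) by auto
  have "deg E w = deg ?E w + 1" if "w \<in> {u, v}" for w
    using deg_insert[of ?E "{u, v}" w] assms(2) that unfolding E by auto
  then have "deg ?E u + deg ?E v < 2 * k" using assms(5) by fastforce
  then have "(\<Sum>c<k. cdeg ?E \<phi> c u + cdeg ?E \<phi> c v) < (\<Sum>c<k. 2)"
    by (simp add: sum.distrib sum_cdeg[OF \<phi>])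
  then obtain c where c: "c < k" "cdeg ?E \<phi> c u + cdeg ?E \<phi> c v < 2"
    by (meson lessThan_iff not_le sum_mono)
  then consider "cdeg ?E \<phi> c u = 0" "cdeg ?E \<phi> c v \<le> 1" | "cdeg ?E \<phi> c v = 0" "cdeg ?E \<phi> c u \<le> 1"
    by linarith
  then show ?thesis
  proof cases
    case 1
    then show ?thesis using linear_coloring_extend[OF \<phi>, of u v c] c assms(4) E
      unfolding linear_colorable_def by auto
  next
    case 2
    then show ?thesis using linear_coloring_extend[OF \<phi>, of v u c] c assms(4) E
      unfolding linear_colorable_def by (auto simp: insert_commute)
  qed
qed

text \<open>Four extensions in a row. The conditional summands add the edges coloured so far to the
  colour degrees, so all side conditions refer to the original colouring. Whether they hold depends
  on the order of the edges and on which end is taken as the new one.\<close>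

lemma linear_colorable_extend4:
  assumes "linear_coloring k E \<phi>"
    and "e1 = {u1, v1}" "e2 = {u2, v2}" "e3 = {u3, v3}" "e4 = {u4, v4}"
    and "distinct [e1, e2, e3, e4]" "{e1, e2, e3, e4} \<inter> E = {}"
    and "u1 \<noteq> v1" "u2 \<noteq> v2" "u3 \<noteq> v3" "u4 \<noteq> v4"
    and "c1 < k" "c2 < k" "c3 < k" "c4 < k"
    and "cdeg E \<phi> c1 u1 = 0" "cdeg E \<phi> c1 v1 \<le> 1"
    and "cdeg E \<phi> c2 u2 + (if c2 = c1 \<and> u2 \<in> e1 then 1 else 0) = 0"
      "cdeg E \<phi> c2 v2 + (if c2 = c1 \<and> v2 \<in> e1 then 1 else 0) \<le> 1"
    and "cdeg E \<phi> c3 u3 + (if c3 = c1 \<and> u3 \<in> e1 then 1 else 0)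
      + (if c3 = c2 \<and> u3 \<in> e2 then 1 else 0) = 0"
      "cdeg E \<phi> c3 v3 + (if c3 = c1 \<and> v3 \<in> e1 then 1 else 0)
      + (if c3 = c2 \<and> v3 \<in> e2 then 1 else 0) \<le> 1"
    and "cdeg E \<phi> c4 u4 + (if c4 = c1 \<and> u4 \<in> e1 then 1 else 0)
      + (if c4 = c2 \<and> u4 \<in> e2 then 1 else 0) + (if c4 = c3 \<and> u4 \<in> e3 then 1 else 0) = 0"
      "cdeg E \<phi> c4 v4 + (if c4 = c1 \<and> v4 \<in> e1 then 1 else 0)
      + (if c4 = c2 \<and> v4 \<in> e2 then 1 else 0) + (if c4 = c3 \<and> v4 \<in> e3 then 1 else 0) \<le> 1"
  shows "linear_coloring k (E \<union> {e1, e2, e3, e4}) (\<phi>(e1 := c1, e2 := c2, e3 := c3, e4 := c4))"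
proof -
  have fin: "finite E" using assms(1) by (rule linear_coloring_finite)
  let ?\<phi>1 = "\<phi>(e1 := c1)" let ?\<phi>2 = "?\<phi>1(e2 := c2)" let ?\<phi>3 = "?\<phi>2(e3 := c3)"
  let ?E1 = "insert e1 E" let ?E2 = "insert e2 ?E1" let ?E3 = "insert e3 ?E2"
  have d1: "cdeg ?E1 ?\<phi>1 d w = cdeg E \<phi> d w + (if d = c1 \<and> w \<in> e1 then 1 else 0)" for d w
    using fin assms(6,7) by (intro cdeg_insert) auto
  have d2: "cdeg ?E2 ?\<phi>2 d w = cdeg ?E1 ?\<phi>1 d w + (if d = c2 \<and> w \<in> e2 then 1 else 0)" for d w
    using fin assms(6,7) by (intro cdeg_insert) auto
  have d3: "cdeg ?E3 ?\<phi>3 d w = cdeg ?E2 ?\<phi>2 d w + (if d = c3 \<and> w \<in> e3 then 1 else 0)" for d w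
    using fin assms(6,7) by (intro cdeg_insert) auto
  have 1: "linear_coloring k ?E1 ?\<phi>1"
    using assms(1,6-) unfolding assms(2) by (intro linear_coloring_extend) (auto simp: assms(2))
  have 2: "linear_coloring k ?E2 ?\<phi>2"
    unfolding assms(3)
  proof (rule linear_coloring_extend[OF 1])
    show "cdeg ?E1 ?\<phi>1 c2 u2 = 0" "cdeg ?E1 ?\<phi>1 c2 v2 \<le> 1"
      unfolding d1 using assms by simp_all
    show "{u2, v2} \<notin> ?E1" unfolding assms(3)[symmetric] using assms(6,7) by auto
  qed fact+
  have 3: "linear_coloring k ?E3 ?\<phi>3"
    unfolding assms(4)
  proof (rule linear_coloring_extend[OF 2])
    show "cdeg ?E2 ?\<phi>2 c3 u3 = 0" "cdeg ?E2 ?\<phi>2 c3 v3 \<le> 1"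
      unfolding d2 d1 using assms by simp_all
    show "{u3, v3} \<notin> ?E2" unfolding assms(4)[symmetric] using assms(6,7) by auto
  qed fact+
  have 4: "linear_coloring k (insert e4 ?E3) (?\<phi>3(e4 := c4))"
    unfolding assms(5)
  proof (rule linear_coloring_extend[OF 3])
    show "cdeg ?E3 ?\<phi>3 c4 u4 = 0" "cdeg ?E3 ?\<phi>3 c4 v4 \<le> 1"
      unfolding d3 d2 d1 using assms by simp_all
    show "{u4, v4} \<notin> ?E3" unfolding assms(5)[symmetric] using assms(6,7) by auto
  qed fact+
  have "insert e4 ?E3 = E \<union> {e1, e2, e3, e4}" by auto
  then show ?thesis using 4 by simp
qed

text \<open>At least two of the \<open>2 * k\<close> places at \<open>v\<close> are free; they
  belong either to one colour or to two different ones.\<close>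

lemma two_spare_colors:
  assumes "linear_coloring k E \<phi>" "deg E v + 2 \<le> 2 * k"
  shows "(\<exists>c<k. cdeg E \<phi> c v = 0) \<or>
    (\<exists>c<k. \<exists>d<k. c \<noteq> d \<and> cdeg E \<phi> c v \<le> 1 \<and> cdeg E \<phi> d v \<le> 1)"
proof -
  have sum: "(\<Sum>c<k. cdeg E \<phi> c v) = deg E v" by (rule sum_cdeg[OF assms(1)])
  then have "(\<Sum>c<k. cdeg E \<phi> c v) < (\<Sum>c<k. 2)" using assms(2) by simp
  then obtain c where c: "c < k" "cdeg E \<phi> c v < 2"
    by (meson lessThan_iff not_le sum_mono)
  show ?thesis
  proof (cases "cdeg E \<phi> c v = 0")
    case False
    have "(\<Sum>c<k. cdeg E \<phi> c v) = cdeg E \<phi> c v + (\<Sum>d\<in>{..<k} - {c}. cdeg E \<phi> d v)"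
      using c by (intro sum.remove) auto
    then have "(\<Sum>d\<in>{..<k} - {c}. cdeg E \<phi> d v) < (\<Sum>d\<in>{..<k} - {c}. 2)"
      using sum assms(2) c False by simp
    then obtain d where "d \<in> {..<k} - {c}" "cdeg E \<phi> d v < 2"
      by (meson not_le sum_mono)
    then show ?thesis using c by (intro disjI2 exI[of _ c] exI[of _ d] conjI) auto
  qed (use c in blast)
qed

section \<open>Colouring a four-cycle with two opposite corners that are new\<close>

text \<open>The two edges at \<open>x1\<close> differ in colour, and so do those at
  \<open>x2\<close>. Hence each edge attaches \<open>x1\<close> or \<open>x2\<close> as a vertex new
  to its colour.\<close>

lemma four_cycle_distinct:
  assumes "linear_coloring k E \<phi>"
    and "distinct [u, a, x1, x2]" "x1 \<notin> \<Union>E" "x2 \<notin> \<Union>E"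
    and "\<alpha>1 < k" "\<alpha>2 < k" "\<beta>1 < k" "\<beta>2 < k" "\<alpha>1 \<noteq> \<beta>1" "\<alpha>2 \<noteq> \<beta>2"
    and "cdeg E \<phi> \<alpha>1 u \<le> 1" "cdeg E \<phi> \<alpha>2 u \<le> 1" "\<alpha>1 = \<alpha>2 \<Longrightarrow> cdeg E \<phi> \<alpha>1 u = 0"
    and "cdeg E \<phi> \<beta>1 a \<le> 1" "cdeg E \<phi> \<beta>2 a \<le> 1" "\<beta>1 = \<beta>2 \<Longrightarrow> cdeg E \<phi> \<beta>1 a = 0"
  shows "linear_colorable k (E \<union> {{u, x1}, {u, x2}, {a, x1}, {a, x2}})"
proof -
  have zero: "cdeg E \<phi> c x1 = 0" "cdeg E \<phi> c x2 = 0" for c using assms(3,4) by (auto intro: cdeg_notin)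
  have new: "{w, x1} \<notin> E" "{x1, w} \<notin> E" "{w, x2} \<notin> E" "{x2, w} \<notin> E" for w using assms(3,4) by auto
  have dist: "u \<noteq> a" "a \<noteq> u" "u \<noteq> x1" "x1 \<noteq> u" "u \<noteq> x2" "x2 \<noteq> u" "a \<noteq> x1" "x1 \<noteq> a" "a \<noteq> x2" "x2 \<noteq> a"
    "x1 \<noteq> x2" "x2 \<noteq> x1" using assms(2) by auto
  have "linear_coloring k (E \<union> {{u, x1}, {u, x2}, {a, x1}, {a, x2}})
      (\<phi>({u, x1} := \<alpha>1, {u, x2} := \<alpha>2, {a, x1} := \<beta>1, {a, x2} := \<beta>2))"
    using assms(1,5-)
    by (intro linear_colorable_extend4[where ?u1.0 = x1 and ?v1.0 = u and ?u2.0 = x2 and ?v2.0 = u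
          and ?u3.0 = x1 and ?v3.0 = a and ?u4.0 = x2 and ?v4.0 = a])
      (auto simp: zero new dist insert_commute doubleton_eq_iff)
  then show ?thesis unfolding linear_colorable_def by blast
qed

text \<open>The path \<open>u\<close>, \<open>x1\<close>, \<open>a\<close>, \<open>x2\<close> gets
  \<open>c\<close> and the closing edge gets \<open>d\<close>. Added in this order, the edges
  prolong a path of colour \<open>c\<close> that may end at \<open>u\<close>; the second step is
  sound because \<open>c\<close> is absent at \<open>a\<close>.\<close>

lemma four_cycle_double:
  assumes "linear_coloring k E \<phi>"
    and "distinct [u, a, x1, x2]" "x1 \<notin> \<Union>E" "x2 \<notin> \<Union>E"
    and "c < k" "d < k" "c \<noteq> d" "cdeg E \<phi> c u \<le> 1" "cdeg E \<phi> d u \<le> 1" "cdeg E \<phi> c a = 0"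
  shows "linear_colorable k (E \<union> {{u, x1}, {u, x2}, {a, x1}, {a, x2}})"
proof -
  have zero: "cdeg E \<phi> c x1 = 0" "cdeg E \<phi> c x2 = 0" for c using assms(3,4) by (auto intro: cdeg_notin)
  have new: "{w, x1} \<notin> E" "{x1, w} \<notin> E" "{w, x2} \<notin> E" "{x2, w} \<notin> E" for w using assms(3,4) by auto
  have dist: "u \<noteq> a" "a \<noteq> u" "u \<noteq> x1" "x1 \<noteq> u" "u \<noteq> x2" "x2 \<noteq> u" "a \<noteq> x1" "x1 \<noteq> a" "a \<noteq> x2" "x2 \<noteq> a"
    "x1 \<noteq> x2" "x2 \<noteq> x1" using assms(2) by auto
  have "linear_coloring k (E \<union> {{u, x1}, {a, x1}, {a, x2}, {u, x2}})
      (\<phi>({u, x1} := c, {a, x1} := c, {a, x2} := c, {u, x2} := d))"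
    using assms(1,5-)
    by (intro linear_colorable_extend4[where ?u1.0 = x1 and ?v1.0 = u and ?u2.0 = a and ?v2.0 = x1
          and ?u3.0 = x2 and ?v3.0 = a and ?u4.0 = x2 and ?v4.0 = u])
      (auto simp: zero new dist insert_commute doubleton_eq_iff)
  moreover have "{{u, x1}, {a, x1}, {a, x2}, {u, x2}} = {{u, x1}, {u, x2}, {a, x1}, {a, x2}}" by auto
  ultimately show ?thesis unfolding linear_colorable_def by metis
qed

lemma four_cycle_zero:
  assumes "linear_coloring k E \<phi>"
    and "distinct [u, a, x1, x2]" "x1 \<notin> \<Union>E" "x2 \<notin> \<Union>E"
    and "c < k" "d < k" "c \<noteq> d" "cdeg E \<phi> c u \<le> 1" "cdeg E \<phi> d u \<le> 1"
    and "z < k" "cdeg E \<phi> z a = 0"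
  shows "linear_colorable k (E \<union> {{u, x1}, {u, x2}, {a, x1}, {a, x2}})"
proof -
  consider "z = c" | "z = d" | "z \<noteq> c" "z \<noteq> d" by blast
  then show ?thesis
  proof cases
    case 1
    then show ?thesis using assms by (intro four_cycle_double[where c = c and d = d]) auto
  next
    case 2
    then show ?thesis using assms by (intro four_cycle_double[where c = d and d = c]) auto
  next
    case 3
    then show ?thesis using assms
      by (intro four_cycle_distinct[where ?\<alpha>1.0 = c and ?\<alpha>2.0 = d and ?\<beta>1.0 = z and ?\<beta>2.0 = z]) auto
  qed
qed

lemma four_cycle_units:
  assumes "linear_coloring k E \<phi>"
    and "distinct [u, a, x1, x2]" "x1 \<notin> \<Union>E" "x2 \<notin> \<Union>E"
    and "c < k" "d < k" "c \<noteq> d" "cdeg E \<phi> c u \<le> 1" "cdeg E \<phi> d u \<le> 1"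
    and "c' < k" "d' < k" "c' \<noteq> d'" "cdeg E \<phi> c' a \<le> 1" "cdeg E \<phi> d' a \<le> 1"
  shows "linear_colorable k (E \<union> {{u, x1}, {u, x2}, {a, x1}, {a, x2}})"
proof (cases "c \<noteq> c' \<and> d \<noteq> d'")
  case True
  then show ?thesis using assms
    by (intro four_cycle_distinct[where ?\<alpha>1.0 = c and ?\<alpha>2.0 = d and ?\<beta>1.0 = c' and ?\<beta>2.0 = d']) auto
next
  \<comment> \<open>If \<open>c = c'\<close> or \<open>d = d'\<close>, the other pairing has no
    coincidence, because \<open>c \<noteq> d\<close> and \<open>c' \<noteq> d'\<close>.\<close>
  case False
  then show ?thesis using assms
    by (intro four_cycle_distinct[where ?\<alpha>1.0 = c and ?\<alpha>2.0 = d and ?\<beta>1.0 = d' and ?\<beta>2.0 = c']) auto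
qed

text \<open>Both \<open>u\<close> and \<open>a\<close> have two places to spare. If one of them has
  these in two colours, or if they have different absent colours, the four-cycle lemmas apply at
  once. The edge \<open>{a, x}\<close> is for the remaining case of a common absent colour.\<close>

lemma four_cycle_pendant_reducible:
  assumes "linear_coloring k E \<phi>"
    and "distinct [u, a, x1, x2]" "x1 \<notin> \<Union>E" "x2 \<notin> \<Union>E"
    and "deg E u + 2 \<le> 2 * k" "deg E a + 2 \<le> 2 * k"
    and "{a, x} \<in> E" "deg E x \<le> 2" "x \<noteq> u" "x \<noteq> a"
  shows "linear_colorable k (E \<union> {{u, x1}, {u, x2}, {a, x1}, {a, x2}})"
proof -
  have fin: "finite E" using assms(1) by (rule linear_coloring_finite)
  have swap: "E \<union> {{u, x1}, {u, x2}, {a, x1}, {a, x2}} = E \<union> {{a, x1}, {a, x2}, {u, x1}, {u, x2}}"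
    by auto
  have dist': "distinct [a, u, x1, x2]" using assms(2) by auto
  note spare = two_spare_colors[OF assms(1)]
  consider c d where "c < k" "d < k" "c \<noteq> d" "cdeg E \<phi> c u \<le> 1" "cdeg E \<phi> d u \<le> 1"
    | c where "c < k" "cdeg E \<phi> c u = 0"
    using spare[OF assms(5)] by blast
  then show ?thesis
  proof cases
    case u: 1
    consider c d where "c < k" "d < k" "c \<noteq> d" "cdeg E \<phi> c a \<le> 1" "cdeg E \<phi> d a \<le> 1"
      | c where "c < k" "cdeg E \<phi> c a = 0"
      using spare[OF assms(6)] by blast
    then show ?thesis
    proof cases
      case 1
      then show ?thesis using four_cycle_units[OF assms(1-4) u] by blast
    next
      case 2
      then show ?thesis using four_cycle_zero[OF assms(1-4) u] by blast
    qed
  next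
    case u: 2
    consider c d where "c < k" "d < k" "c \<noteq> d" "cdeg E \<phi> c a \<le> 1" "cdeg E \<phi> d a \<le> 1"
      | c' where "c' < k" "cdeg E \<phi> c' a = 0" "c' \<noteq> c" | "cdeg E \<phi> c a = 0"
      using spare[OF assms(6)] by metis
    then show ?thesis
    proof cases
      case 1
      then show ?thesis unfolding swap using four_cycle_zero[OF assms(1) dist' assms(3,4) _ _ _ _ _ u] by blast
    next
      case 2
      then show ?thesis using u assms(1-4)
        by (intro four_cycle_distinct[where ?\<alpha>1.0 = c and ?\<alpha>2.0 = c and ?\<beta>1.0 = c' and ?\<beta>2.0 = c']) auto
    next
      case 3
      \<comment> \<open>Possibly \<open>c\<close> is the only colour to spare at \<open>u\<close> and \<open>a\<close>, and using it four times would close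
        a cycle. Recolouring the edge \<open>{a, x}\<close> with \<open>c\<close> frees its old colour at \<open>a\<close>.\<close>
      define \<gamma> where "\<gamma> = \<phi> {a, x}"
      let ?F = "E - {{a, x}}" and ?\<psi> = "\<phi>({a, x} := c)"
      have F: "insert {a, x} ?F = E" using assms(7) by auto
      have \<gamma>: "\<gamma> < k" using assms(1,7) unfolding \<gamma>_def linear_coloring_def by blast
      have col: "cdeg E \<phi> d w = cdeg ?F \<phi> d w + (if d = \<gamma> \<and> w \<in> {a, x} then 1 else 0)" for d w
        using cdeg_insert[of ?F "{a, x}" \<phi> \<gamma> d w] fin unfolding F \<gamma>_def by simp
      have ne: "\<gamma> \<noteq> c" using col[of \<gamma> a] 3 by auto
      have F_col: "linear_coloring k ?F \<phi>" using assms(1) by (rule linear_coloring_subset) auto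
      have "cdeg ?F \<phi> c x \<le> deg ?F x"
        unfolding cdeg_def using fin by (intro card_mono) auto
      moreover have "deg E x = deg ?F x + 1"
        using deg_insert[of ?F "{a, x}" x] fin unfolding F by simp
      ultimately have "cdeg ?F \<phi> c x \<le> 1" using assms(8) by simp
      moreover have "cdeg ?F \<phi> c a = 0" using col[of c a] 3 by simp
      ultimately have \<psi>: "linear_coloring k E ?\<psi>"
        using linear_coloring_extend[OF F_col, of a x c] assms(10) u unfolding F by auto
      have col': "cdeg E ?\<psi> d w = cdeg ?F \<phi> d w + (if d = c \<and> w \<in> {a, x} then 1 else 0)" for d w
        using cdeg_insert[of ?F "{a, x}" \<phi> c d w] fin unfolding F by simp
      have "cdeg E ?\<psi> c u = 0" using col'[of c u] col[of c u] u assms(2,9) by auto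
      moreover have "cdeg E ?\<psi> c a \<le> 1" using col'[of c a] col[of c a] 3 by simp
      moreover have "cdeg E ?\<psi> \<gamma> a \<le> 1"
        using col'[of \<gamma> a] col[of \<gamma> a] ne cdeg_le_2[OF assms(1), of \<gamma> a] by simp
      ultimately show ?thesis
        unfolding swap using four_cycle_zero[OF \<psi> dist' assms(3,4) u(1) \<gamma> ne[symmetric]] u(1) by blast
    qed
  qed
qed

text \<open>Each of \<open>i\<close> and \<open>j\<close> has a colour that is absent and another
  that occurs at most once. If the absent colours agree, this colour takes the path
  \<open>i\<close>, \<open>b\<close>, \<open>a\<close>, \<open>j\<close> as a new component, and the
  other takes \<open>{i, a}\<close> and \<open>{j, b}\<close>, each ending in a new leaf. Otherwise
  the colour absent at \<open>j\<close> takes the path \<open>i\<close>, \<open>a\<close>,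
  \<open>b\<close>, \<open>j\<close>, prolonging a path that may end at \<open>i\<close>, and the
  other takes \<open>{j, a}\<close> and \<open>{i, b}\<close>.\<close>

lemma cubic_reducible:
  assumes "linear_coloring 2 E \<phi>"
    and "distinct [i, j, a, b]" "a \<notin> \<Union>E" "b \<notin> \<Union>E" "deg E i \<le> 1" "deg E j \<le> 1"
  shows "linear_colorable 2 (E \<union> {{a, b}, {i, a}, {i, b}, {j, a}, {j, b}})"
proof -
  have fin: "finite E" using assms(1) by (rule linear_coloring_finite)
  \<comment> \<open>The colours are 0 and 1, so \<open>1 - c\<close> is the other colour.\<close>
  have ex: "\<exists>c<2. cdeg E \<phi> (1 - c) w = 0 \<and> cdeg E \<phi> c w \<le> 1" if "deg E w \<le> 1" for w
  proof -
    have "cdeg E \<phi> 0 w + cdeg E \<phi> 1 w \<le> 1"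
      using sum_cdeg[OF assms(1), of w] that by (simp add: numeral_2_eq_2 lessThan_Suc)
    then have "cdeg E \<phi> 1 w = 0 \<and> cdeg E \<phi> 0 w \<le> 1 \<or> cdeg E \<phi> 0 w = 0 \<and> cdeg E \<phi> 1 w \<le> 1" by linarith
    then show ?thesis
    proof
      assume "cdeg E \<phi> 1 w = 0 \<and> cdeg E \<phi> 0 w \<le> 1"
      then show ?thesis by (intro exI[of _ 0]) simp
    next
      assume "cdeg E \<phi> 0 w = 0 \<and> cdeg E \<phi> 1 w \<le> 1"
      then show ?thesis by (intro exI[of _ 1]) simp
    qed
  qed
  obtain c where c: "c < 2" "cdeg E \<phi> (1 - c) i = 0" "cdeg E \<phi> c i \<le> 1" using ex[OF assms(5)] by blast
  obtain d where d: "d < 2" "cdeg E \<phi> (1 - d) j = 0" "cdeg E \<phi> d j \<le> 1" using ex[OF assms(6)] by blast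
  have zero: "cdeg E \<phi> c a = 0" "cdeg E \<phi> c b = 0" for c using assms(3,4) by (auto intro: cdeg_notin)
  define c' where "c' = 1 - c"
  have c': "c' < 2" "c' \<noteq> c" "cdeg E \<phi> c' i = 0" using c unfolding c'_def by (auto simp: less_2_cases_iff)
  have notin: "{w, a} \<notin> E" "{a, w} \<notin> E" "{w, b} \<notin> E" "{b, w} \<notin> E" for w using assms(3,4) by auto
  have dist: "i \<noteq> j" "j \<noteq> i" "i \<noteq> a" "a \<noteq> i" "i \<noteq> b" "b \<noteq> i" "j \<noteq> a" "a \<noteq> j" "j \<noteq> b" "b \<noteq> j"
    "a \<noteq> b" "b \<noteq> a" using assms(2) by auto
  have new: "{a, b} \<notin> E" using assms(3) by auto
  have ab: "a \<noteq> b" using assms(2) by auto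
  show ?thesis
  proof (cases "c = d")
    case True
    let ?E = "insert {a, b} E" and ?\<psi> = "\<phi>({a, b} := c')"
    have \<psi>: "linear_coloring 2 ?E ?\<psi>"
      using linear_coloring_extend[OF assms(1) new ab] zero c' by simp
    have cd: "cdeg ?E ?\<psi> e w = cdeg E \<phi> e w + (if e = c' \<and> w \<in> {a, b} then 1 else 0)" for e w
      using fin new by (rule cdeg_insert)
    have "cdeg E \<phi> c' j = 0" using d True unfolding c'_def by simp
    then have "linear_coloring 2 (?E \<union> {{i, b}, {j, a}, {i, a}, {j, b}})
      (?\<psi>({i, b} := c', {j, a} := c', {i, a} := c, {j, b} := c))"
      using c c' d True
      by (intro linear_colorable_extend4[OF \<psi>, where ?u1.0 = i and ?v1.0 = b and ?u2.0 = j and ?v2.0 = a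
          and ?u3.0 = a and ?v3.0 = i and ?u4.0 = b and ?v4.0 = j])
        (auto simp: zero notin dist insert_commute doubleton_eq_iff cd)
    moreover have "?E \<union> {{i, b}, {j, a}, {i, a}, {j, b}} = E \<union> {{a, b}, {i, a}, {i, b}, {j, a}, {j, b}}"
      by auto
    ultimately show ?thesis unfolding linear_colorable_def by metis
  next
    case False
    then have "d = c'" using c d unfolding c'_def by (auto simp: less_2_cases_iff)
    then have j: "cdeg E \<phi> c j = 0" "cdeg E \<phi> c' j \<le> 1" using c d unfolding c'_def by (auto simp: less_2_cases_iff)
    let ?E = "insert {a, i} E" and ?\<psi> = "\<phi>({a, i} := c)"
    have \<psi>: "linear_coloring 2 ?E ?\<psi>"
      using linear_coloring_extend[of 2 E \<phi> a i c] assms(1) notin dist zero c by simp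
    have cd: "cdeg ?E ?\<psi> e w = cdeg E \<phi> e w + (if e = c \<and> w \<in> {a, i} then 1 else 0)" for e w
      using fin notin(2) by (rule cdeg_insert)
    have "linear_coloring 2 (?E \<union> {{a, b}, {j, b}, {j, a}, {i, b}})
      (?\<psi>({a, b} := c, {j, b} := c, {j, a} := c', {i, b} := c'))"
      using c c' j
      by (intro linear_colorable_extend4[OF \<psi>, where ?u1.0 = b and ?v1.0 = a and ?u2.0 = j and ?v2.0 = b
          and ?u3.0 = a and ?v3.0 = j and ?u4.0 = i and ?v4.0 = b])
        (auto simp: zero notin dist insert_commute doubleton_eq_iff cd)
    moreover have "?E \<union> {{a, b}, {j, b}, {j, a}, {i, b}} = E \<union> {{a, b}, {i, a}, {i, b}, {j, a}, {j, b}}"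
      by (auto simp: insert_commute)
    ultimately show ?thesis unfolding linear_colorable_def by metis
  qed
qed

section \<open>Uncrossed intervals\<close>

text \<open>The inequalities are strict, so edges with a common end never interleave; the
  disjunction makes the relation symmetric.\<close>

definition pos_crosses :: "('a \<Rightarrow> real) \<Rightarrow> 'a set \<Rightarrow> 'a set \<Rightarrow> bool" where
  "pos_crosses p e f \<longleftrightarrow> (\<exists>a b c d. p a < p b \<and> p b < p c \<and> p c < p d \<and>
     ({a, c} = e \<and> {b, d} = f \<or> {a, c} = f \<and> {b, d} = e))"

definition one_crossing :: "('a \<Rightarrow> real) \<Rightarrow> 'a set set \<Rightarrow> bool" where
  "one_crossing p E \<longleftrightarrow> inj_on p (\<Union>E) \<and>
     (\<forall>e\<in>E. \<forall>f\<in>E. \<forall>g\<in>E. pos_crosses p e f \<longrightarrow> pos_crosses p e g \<longrightarrow> f = g)"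

definition inner_verts :: "('a \<Rightarrow> real) \<Rightarrow> 'a set set \<Rightarrow> real \<Rightarrow> real \<Rightarrow> 'a set" where
  "inner_verts p E i j = {v \<in> \<Union>E. i < p v \<and> p v < j}"

text \<open>The ends \<open>i\<close> and \<open>j\<close> are positions that may be unoccupied,
  which admits an interval around all vertices. Edges from the inside may end at \<open>i\<close> or
  \<open>j\<close>, but not pass over them.\<close>

definition uncrossed :: "('a \<Rightarrow> real) \<Rightarrow> 'a set set \<Rightarrow> real \<Rightarrow> real \<Rightarrow> bool" where
  "uncrossed p E i j \<longleftrightarrow> (\<forall>u v. {u, v} \<in> E \<longrightarrow> i < p u \<longrightarrow> p u < j \<longrightarrow> i \<le> p v \<and> p v \<le> j)"

lemma one_crossing_subset: "one_crossing p E \<Longrightarrow> F \<subseteq> E \<Longrightarrow> one_crossing p F"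
  unfolding one_crossing_def by (meson Union_mono inj_on_subset subsetD)

lemma one_crossingD:
  assumes "one_crossing p E" "{a, c} \<in> E" "{b, d} \<in> E" "{x, y} \<in> E"
    and "p a < p b" "p b < p c" "p c < p d"
    and "pos_crosses p {a, c} {x, y} \<or> pos_crosses p {b, d} {x, y}"
  shows "{x, y} = {a, c} \<or> {x, y} = {b, d}"
proof -
  have "pos_crosses p {a, c} {b, d}" "pos_crosses p {b, d} {a, c}"
    unfolding pos_crosses_def using assms by blast+
  then show ?thesis using assms unfolding one_crossing_def by metis
qed

lemma pos_crossesI:
  "p a < p b \<Longrightarrow> p b < p c \<Longrightarrow> p c < p d \<Longrightarrow> pos_crosses p {a, c} {b, d}"
  "p a < p b \<Longrightarrow> p b < p c \<Longrightarrow> p c < p d \<Longrightarrow> pos_crosses p {b, d} {a, c}"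
  "p a < p b \<Longrightarrow> p b < p c \<Longrightarrow> p c < p d \<Longrightarrow> pos_crosses p {c, a} {b, d}"
  "p a < p b \<Longrightarrow> p b < p c \<Longrightarrow> p c < p d \<Longrightarrow> pos_crosses p {b, d} {c, a}"
  "p a < p b \<Longrightarrow> p b < p c \<Longrightarrow> p c < p d \<Longrightarrow> pos_crosses p {a, c} {d, b}"
  "p a < p b \<Longrightarrow> p b < p c \<Longrightarrow> p c < p d \<Longrightarrow> pos_crosses p {d, b} {a, c}"
  "p a < p b \<Longrightarrow> p b < p c \<Longrightarrow> p c < p d \<Longrightarrow> pos_crosses p {c, a} {d, b}"
  "p a < p b \<Longrightarrow> p b < p c \<Longrightarrow> p c < p d \<Longrightarrow> pos_crosses p {d, b} {c, a}"
  unfolding pos_crosses_def by (metis insert_commute)+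

text \<open>A chord \<open>{x, y}\<close> separating two consecutive corners of a crossing \<open>{a, c}\<close>, \<open>{b, d}\<close>
  would have to cross one of the two chords again.\<close>

lemma uncrossed_quad:
  assumes "one_crossing p E" "{a, c} \<in> E" "{b, d} \<in> E"
    and "p a < p b" "p b < p c" "p c < p d"
  shows "uncrossed p E (p a) (p b)" "uncrossed p E (p b) (p c)" "uncrossed p E (p c) (p d)"
    "uncrossed p E (p a) (p d)"
proof -
  have inj: "p u = p v \<Longrightarrow> u = v" if "u \<in> \<Union>E" "v \<in> \<Union>E" for u v
    using assms(1) that unfolding one_crossing_def by (auto dest: inj_onD)
  have abcd: "a \<in> \<Union>E" "b \<in> \<Union>E" "c \<in> \<Union>E" "d \<in> \<Union>E" using assms by auto
  have *: "(x = a \<or> x = b \<or> x = c \<or> x = d) \<and> (y = a \<or> y = b \<or> y = c \<or> y = d)"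
    if "{x, y} \<in> E" "pos_crosses p {a, c} {x, y} \<or> pos_crosses p {b, d} {x, y}" for x y
    using one_crossingD[OF assms(1-3) that(1) assms(4-6) that(2)] by (auto simp: doubleton_eq_iff)
  have split: "p y < p a \<or> p y = p a \<or> p a < p y \<and> p y < p b \<or> p y = p b \<or> p b < p y \<and> p y < p c
    \<or> p y = p c \<or> p c < p y \<and> p y < p d \<or> p y = p d \<or> p d < p y" for y by linarith
  show "uncrossed p E (p a) (p b)"
    unfolding uncrossed_def
  proof (intro allI impI, rule ccontr)
    fix x y assume xy: "{x, y} \<in> E" "p a < p x" "p x < p b" and n: "\<not> (p a \<le> p y \<and> p y \<le> p b)"
    have "y \<in> \<Union>E" using xy by auto
    then have eq: "p y = p c \<Longrightarrow> y = c" "p y = p d \<Longrightarrow> y = d" using inj abcd by blast+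
    have "pos_crosses p {a, c} {x, y} \<or> pos_crosses p {b, d} {x, y}"
      using split[of y] n xy(2,3) assms(4-6)
      by (smt (verit) pos_crossesI eq)
    then show False using *[OF xy(1)] xy(2,3) assms(4-6) by auto
  qed
  show "uncrossed p E (p b) (p c)"
    unfolding uncrossed_def
  proof (intro allI impI, rule ccontr)
    fix x y assume xy: "{x, y} \<in> E" "p b < p x" "p x < p c" and n: "\<not> (p b \<le> p y \<and> p y \<le> p c)"
    have "y \<in> \<Union>E" using xy by auto
    then have eq: "p y = p a \<Longrightarrow> y = a" "p y = p d \<Longrightarrow> y = d" using inj abcd by blast+
    have "pos_crosses p {a, c} {x, y} \<or> pos_crosses p {b, d} {x, y}"
      using split[of y] n xy(2,3) assms(4-6)
      by (smt (verit) pos_crossesI eq)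
    then show False using *[OF xy(1)] xy(2,3) assms(4-6) by auto
  qed
  show "uncrossed p E (p c) (p d)"
    unfolding uncrossed_def
  proof (intro allI impI, rule ccontr)
    fix x y assume xy: "{x, y} \<in> E" "p c < p x" "p x < p d" and n: "\<not> (p c \<le> p y \<and> p y \<le> p d)"
    have "y \<in> \<Union>E" using xy by auto
    then have eq: "p y = p a \<Longrightarrow> y = a" "p y = p b \<Longrightarrow> y = b" using inj abcd by blast+
    have "pos_crosses p {a, c} {x, y} \<or> pos_crosses p {b, d} {x, y}"
      using split[of y] n xy(2,3) assms(4-6)
      by (smt (verit) pos_crossesI eq)
    then show False using *[OF xy(1)] xy(2,3) assms(4-6) by auto
  qed
  show "uncrossed p E (p a) (p d)"
    unfolding uncrossed_def
  proof (intro allI impI, rule ccontr)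
    fix x y assume xy: "{x, y} \<in> E" "p a < p x" "p x < p d" and n: "\<not> (p a \<le> p y \<and> p y \<le> p d)"
    have "x \<in> \<Union>E" using xy by auto
    then have eq: "p x = p b \<Longrightarrow> x = b" "p x = p c \<Longrightarrow> x = c" using inj abcd by blast+
    have "pos_crosses p {a, c} {x, y} \<or> pos_crosses p {b, d} {x, y}"
      using split[of x] n xy(2,3) assms(4-6)
      by (smt (verit) pos_crossesI eq)
    then show False using *[OF xy(1)] n assms(4-6) by auto
  qed
qed

lemma finite_Union_card_2: "finite E \<Longrightarrow> \<forall>e\<in>E. card e = 2 \<Longrightarrow> finite (\<Union>E)"
  by (metis card.infinite finite_Union zero_neq_numeral)

lemma finite_inner_verts: "finite E \<Longrightarrow> \<forall>e\<in>E. card e = 2 \<Longrightarrow> finite (inner_verts p E i j)"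
  by (rule finite_subset[of _ "\<Union>E"]) (auto simp: inner_verts_def finite_Union_card_2)

text \<open>Let \<open>a\<close> be the rightmost inner vertex for which the part from
  \<open>i\<close> to \<open>a\<close> is uncrossed. If the rest is not uncrossed, an edge
  \<open>{x, y}\<close> leaves it to the left, and it can only end at \<open>i\<close>. By the
  choice of \<open>a\<close> some edge leaves the part from \<open>i\<close> to \<open>x\<close>; it
  interleaves with \<open>{x, y}\<close>, and the maximality of \<open>a\<close> forces its ends to
  be \<open>a\<close> and a vertex at \<open>j\<close>. The corners of this crossing give the three
  parts.\<close>

lemma uncrossed_split:
  assumes "finite E" "\<forall>e\<in>E. card e = 2" "one_crossing p E" "uncrossed p E i j" "inner_verts p E i j \<noteq> {}"
  obtains (T) a where "a \<in> inner_verts p E i j" "uncrossed p E i (p a)" "uncrossed p E (p a) j"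
  | (X) a b where "a \<in> inner_verts p E i j" "b \<in> inner_verts p E i j" "p a < p b"
      "uncrossed p E i (p a)" "uncrossed p E (p a) (p b)" "uncrossed p E (p b) j"
proof -
  have inj: "p u = p v \<Longrightarrow> u = v" if "u \<in> \<Union>E" "v \<in> \<Union>E" for u v
    using assms(3) that unfolding one_crossing_def by (auto dest: inj_onD)
  define S where "S = {a \<in> inner_verts p E i j. uncrossed p E i (p a)}"
  have finI: "finite (inner_verts p E i j)" using assms(1,2) by (rule finite_inner_verts)
  then have finS: "finite S" unfolding S_def by auto
  obtain a0 where a0: "a0 \<in> inner_verts p E i j" "\<forall>x\<in>inner_verts p E i j. p a0 \<le> p x"
    using ex_is_arg_min_if_finite[OF finI assms(5), of p] unfolding is_arg_min_linorder by blast
  have "uncrossed p E i (p a0)"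
    unfolding uncrossed_def
  proof (intro allI impI)
    fix u v assume "{u, v} \<in> E" "i < p u" "p u < p a0"
    then have "u \<in> inner_verts p E i j" using a0(1) unfolding inner_verts_def by auto
    then show "i \<le> p v \<and> p v \<le> p a0" using a0(2) \<open>p u < p a0\<close> by (meson not_le)
  qed
  then have "S \<noteq> {}" using a0 unfolding S_def by blast
  then obtain a where a: "a \<in> S" "\<forall>x\<in>S. p x \<le> p a"
    using ex_is_arg_min_if_finite[OF finS, of "\<lambda>x. - p x"] unfolding is_arg_min_linorder by auto
  have ain: "a \<in> inner_verts p E i j" "uncrossed p E i (p a)" using a unfolding S_def by auto
  have ai: "i < p a" "p a < j" "a \<in> \<Union>E" using ain unfolding inner_verts_def by auto
  show thesis
  proof (cases "uncrossed p E (p a) j")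
    case True
    then show ?thesis using T ain by blast
  next
    case False
    then obtain x y where xy: "{x, y} \<in> E" "p a < p x" "p x < j" "\<not> (p a \<le> p y \<and> p y \<le> j)"
      unfolding uncrossed_def by blast
    have "i \<le> p y" "p y \<le> j" using assms(4) xy ai unfolding uncrossed_def by force+
    then have y: "i \<le> p y" "p y < p a" using xy by auto
    have yi: "p y = i"
    proof (rule ccontr)
      assume "p y \<noteq> i"
      then have "p x \<le> p a" using ain(2) xy(1) y unfolding uncrossed_def by (metis insert_commute order_le_less)
      then show False using xy by simp
    qed
    have xin: "x \<in> inner_verts p E i j" using xy ai unfolding inner_verts_def by auto
    have "\<not> uncrossed p E i (p x)" using a(2) xin xy(2) unfolding S_def by force
    then obtain c d where cd: "{c, d} \<in> E" "i < p c" "p c < p x" "\<not> (i \<le> p d \<and> p d \<le> p x)"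
      unfolding uncrossed_def by blast
    have dj: "p x < p d" "p d \<le> j" using assms(4) cd xy(3) unfolding uncrossed_def by force+
    have "p a \<le> p c"
    proof (rule ccontr)
      assume "\<not> p a \<le> p c"
      then have "p d \<le> p a" using ain(2) cd unfolding uncrossed_def by force
      then show False using dj xy by simp
    qed
    have yx: "{y, x} \<in> E" using xy(1) by (simp add: insert_commute)
    have q: "p y < p c" using yi cd by simp
    note quad = uncrossed_quad[OF assms(3) yx cd(1) q cd(3) dj(1)]
    have "c \<in> S" using cd xy(3) quad(1) unfolding S_def inner_verts_def yi by auto
    then have "p c \<le> p a" using a(2) by blast
    then have "c = a" using \<open>p a \<le> p c\<close> inj[of c a] cd(1) ai(3) by auto
    have "p d = j"
    proof (rule ccontr)
      assume "p d \<noteq> j"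
      then have "d \<in> S" using cd dj xy(2) ai quad(4) unfolding S_def inner_verts_def yi by auto
      then show False using a(2) dj xy(2) by force
    qed
    then show ?thesis using X[OF ain(1) xin xy(2) ain(2)] quad \<open>c = a\<close> by simp
  qed
qed

lemma deg_eq_card_neighbours:
  assumes "\<forall>e\<in>E. card e = 2"
  shows "deg E v = card {u. {v, u} \<in> E}"
proof -
  have "{e \<in> E. v \<in> e} = (\<lambda>u. {v, u}) ` {u. {v, u} \<in> E}"
  proof
    show "{e \<in> E. v \<in> e} \<subseteq> (\<lambda>u. {v, u}) ` {u. {v, u} \<in> E}"
    proof
      fix e assume e: "e \<in> {e \<in> E. v \<in> e}"
      then obtain x y where "e = {x, y}" using assms by (auto simp: card_2_iff)
      then have "e = {v, if x = v then y else x}" using e by auto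
      then show "e \<in> (\<lambda>u. {v, u}) ` {u. {v, u} \<in> E}" using e by (metis (no_types, lifting) imageI mem_Collect_eq)
    qed
  qed auto
  moreover have "inj (\<lambda>u. {v, u})" by (auto simp: inj_on_def doubleton_eq_iff)
  ultimately show ?thesis by (simp add: card_image inj_on_subset)
qed

section \<open>Minimal intervals in edge-minimal counterexamples\<close>

text \<open>The interval is one with fewest inner vertices. Candidates exist: reaching one unit
  beyond the outermost positions makes every vertex an inner one.\<close>

lemma minimal_uncrossed:
  assumes "finite E" "\<forall>e\<in>E. card e = 2" "v \<in> \<Union>E" "Q v"
  obtains i j where "uncrossed p E i j" "\<exists>x\<in>inner_verts p E i j. Q x"
    "\<And>i' j' x. uncrossed p E i' j' \<Longrightarrow> inner_verts p E i' j' \<subset> inner_verts p E i j \<Longrightarrow> x \<in> inner_verts p E i' j' \<Longrightarrow> \<not> Q x"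
proof -
  have fin: "finite (p ` \<Union>E)" using finite_Union_card_2[OF assms(1,2)] by simp
  define P where "P = (\<lambda>(i, j). uncrossed p E i j \<and> (\<exists>x\<in>inner_verts p E i j. Q x))"
  define l where "l = Min (p ` \<Union>E) - 1"
  define r where "r = Max (p ` \<Union>E) + 1"
  have range: "l < p x \<and> p x < r" if "x \<in> \<Union>E" for x
  proof -
    have "Min (p ` \<Union>E) \<le> p x" "p x \<le> Max (p ` \<Union>E)" using that fin by auto
    then show ?thesis unfolding l_def r_def by linarith
  qed
  have "uncrossed p E l r" unfolding uncrossed_def
  proof (intro allI impI)
    fix u v assume "{u, v} \<in> E"
    then have "v \<in> \<Union>E" by auto
    then show "l \<le> p v \<and> p v \<le> r" using range less_imp_le by blast
  qed
  moreover have "v \<in> inner_verts p E l r" using assms(3) range unfolding inner_verts_def by blast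
  ultimately have "P (l, r)" using assms(4) unfolding P_def by auto
  then obtain ij where ij: "P ij" "\<forall>y. P y \<longrightarrow> card (inner_verts p E (fst ij) (snd ij)) \<le> card (inner_verts p E (fst y) (snd y))"
    using ex_has_least_nat[of P "(l, r)" "\<lambda>y. card (inner_verts p E (fst y) (snd y))"] by blast
  show thesis
  proof (rule that)
    show "uncrossed p E (fst ij) (snd ij)" "\<exists>x\<in>inner_verts p E (fst ij) (snd ij). Q x"
      using ij(1) unfolding P_def by (auto simp: case_prod_unfold)
    fix i' j' x assume *: "uncrossed p E i' j'" "inner_verts p E i' j' \<subset> inner_verts p E (fst ij) (snd ij)" "x \<in> inner_verts p E i' j'"
    show "\<not> Q x"
    proof
      assume "Q x"
      then have "P (i', j')" using * unfolding P_def by auto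
      then have "card (inner_verts p E (fst ij) (snd ij)) \<le> card (inner_verts p E i' j')" using ij(2) by force
      moreover have "card (inner_verts p E i' j') < card (inner_verts p E (fst ij) (snd ij))"
        using *(2) finite_inner_verts[OF assms(1,2)] by (simp add: psubset_card_mono)
      ultimately show False by simp
    qed
  qed
qed

text \<open>What an edge-minimal counterexample satisfies once light edges are excluded. Both ranges
  of \<open>k\<close> share it; the colourability of proper subsets is an assumption of the lemmas
  that colour.\<close>

locale critical =
  fixes p :: "'a \<Rightarrow> real" and E :: "'a set set" and k :: nat
  assumes fin: "finite E" and two: "\<forall>e\<in>E. card e = 2" and one: "one_crossing p E"
    and max_deg: "deg E v \<le> 2 * k"
    and light: "{u, v} \<in> E \<Longrightarrow> 2 * k + 2 \<le> deg E u + deg E v"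
begin

abbreviation N where "N v \<equiv> {u. {v, u} \<in> E}"

lemma deg_N: "deg E v = card (N v)"
  using two by (rule deg_eq_card_neighbours)

lemma finV: "finite (\<Union>E)"
  using fin two by (rule finite_Union_card_2)

lemma N_subset: "N v \<subseteq> \<Union>E"
  by blast

lemma N_irrefl: "v \<notin> N v"
  using two by force

lemma pos_eq: "u \<in> \<Union>E \<Longrightarrow> v \<in> \<Union>E \<Longrightarrow> p u = p v \<Longrightarrow> u = v"
  using one unfolding one_crossing_def by (auto dest: inj_onD)

lemma finite_pos: "finite {w \<in> \<Union>E. p w \<in> S}"
  by (rule finite_subset[OF _ finV]) auto

lemma card_pos:
  assumes "finite S"
  shows "card {w \<in> \<Union>E. p w \<in> S} \<le> card S"
proof -
  have "inj_on p {w \<in> \<Union>E. p w \<in> S}"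
    using one unfolding one_crossing_def by (auto intro: inj_on_subset)
  then show ?thesis using assms by (intro card_inj_on_le[of p]) auto
qed

text \<open>Adjacent inner vertices would have degree sum at most 6, less than
  \<open>2 * k + 2\<close>. So all neighbours of \<open>x\<close> sit at \<open>l\<close> and
  \<open>r\<close>, which bounds its degree by two. As they have degree at most
  \<open>2 * k\<close>, the degree of \<open>x\<close> is exactly two and theirs is at least
  \<open>2 * k\<close>.\<close>

lemma leaf_neighbours:
  assumes "3 \<le> k" "uncrossed p E l r" "\<And>x. x \<in> inner_verts p E l r \<Longrightarrow> deg E x \<le> 3" "x \<in> inner_verts p E l r"
  obtains y z where "p y = l" "p z = r" "N x = {y, z}" "y \<noteq> z" "deg E x = 2"
    "2 * k \<le> deg E y" "2 * k \<le> deg E z"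
proof -
  have sub: "N x \<subseteq> {w \<in> \<Union>E. p w \<in> {l, r}}"
  proof
    fix u assume u: "u \<in> N x"
    have "u \<notin> inner_verts p E l r"
      using light[of x u] u assms(1) assms(3)[of u] assms(3)[OF assms(4)] by force
    moreover have "l \<le> p u" "p u \<le> r" using assms(2,4) u unfolding uncrossed_def inner_verts_def by blast+
    moreover have "u \<in> \<Union>E" using u by blast
    ultimately show "u \<in> {w \<in> \<Union>E. p w \<in> {l, r}}" unfolding inner_verts_def by auto
  qed
  have "card (N x) \<le> card {w \<in> \<Union>E. p w \<in> {l, r}}" using finite_pos sub by (rule card_mono)
  also have "\<dots> \<le> card {l, r}" by (rule card_pos) simp
  also have "\<dots> \<le> 2" by (simp add: card_insert_if)
  finally have le2: "deg E x \<le> 2" unfolding deg_N .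
  have "N x \<noteq> {}"
  proof -
    obtain e where e: "e \<in> E" "x \<in> e" using assms(4) unfolding inner_verts_def by blast
    then obtain a b where "e = {a, b}" using two by (meson card_2_iff)
    then show ?thesis using e by (auto simp: insert_commute)
  qed
  then obtain u where "u \<in> N x" by blast
  then have "2 \<le> deg E x" using light[of x u] max_deg[of u] by simp
  then have deg2: "deg E x = 2" using le2 by simp
  then have "card (N x) = 2" unfolding deg_N .
  then obtain y z where yz: "N x = {y, z}" "y \<noteq> z" unfolding card_2_iff by blast
  have "y \<in> \<Union>E" "z \<in> \<Union>E" using yz N_subset[of x] by auto
  then have "p y \<noteq> p z" using pos_eq yz(2) by blast
  moreover have "p y \<in> {l, r}" "p z \<in> {l, r}" using sub yz by auto
  moreover have "2 * k \<le> deg E y" "2 * k \<le> deg E z" using light[of x y] light[of x z] yz(1) deg2 by auto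
  ultimately show thesis using that[of y z] that[of z y] yz deg2 by auto
qed

text \<open>With three inner vertices, the edge from the leftmost one to \<open>r\<close> would
  interleave with the edges from the other two to \<open>l\<close>.\<close>

lemma leaf_card:
  assumes "3 \<le> k" "uncrossed p E l r" "\<And>x. x \<in> inner_verts p E l r \<Longrightarrow> deg E x \<le> 3"
  shows "card (inner_verts p E l r) \<le> 2"
proof (rule ccontr)
  assume "\<not> ?thesis"
  then have card: "3 \<le> card (inner_verts p E l r)" by simp
  have finI: "finite (inner_verts p E l r)" using fin two by (rule finite_inner_verts)
  have "inner_verts p E l r \<noteq> {}" using card by auto
  then obtain x where x: "x \<in> inner_verts p E l r" "\<forall>w\<in>inner_verts p E l r. p x \<le> p w"
    using ex_is_arg_min_if_finite[OF finI, of p] unfolding is_arg_min_linorder by blast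
  have "2 \<le> card (inner_verts p E l r - {x})" using card x finI by simp
  then obtain y z where yz: "y \<in> inner_verts p E l r - {x}" "z \<in> inner_verts p E l r - {x}" "y \<noteq> z"
    by (meson card_2_iff' obtain_subset_with_card_n subsetD)
  have V: "w \<in> \<Union>E" if "w \<in> inner_verts p E l r" for w using that unfolding inner_verts_def by blast
  have lt: "p x < p w" if "w \<in> inner_verts p E l r - {x}" for w
    using that x pos_eq[of x w] V by (metis DiffD1 DiffD2 insertI1 order_le_less)
  obtain v v' where v: "p v = l" "{y, v} \<in> E" and "p v' = r" "{y, v'} \<in> E"
    by (rule leaf_neighbours[OF assms, of y]) (use yz in auto)
  obtain u u' where u: "p u = l" "{z, u} \<in> E" and "p u' = r" "{z, u'} \<in> E"
    by (rule leaf_neighbours[OF assms, of z]) (use yz in auto)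
  obtain w w' where w: "p w' = l" "{x, w'} \<in> E" "p w = r" "{x, w} \<in> E"
    by (rule leaf_neighbours[OF assms, of x]) (use x in auto)
  have "u = v" by (rule pos_eq) (use u v in auto)
  have "pos_crosses p {x, w} {y, v}" by (rule pos_crossesI(4)) (use lt yz v w x in \<open>auto simp: inner_verts_def\<close>)
  moreover have "pos_crosses p {x, w} {z, v}" by (rule pos_crossesI(4)) (use lt yz v w x in \<open>auto simp: inner_verts_def\<close>)
  ultimately have "{y, v} = {z, v}" using one u v w \<open>u = v\<close> unfolding one_crossing_def by blast
  then show False using yz(3) by (auto simp: doubleton_eq_iff)
qed

text \<open>The position \<open>m\<close> allows for one neighbour of \<open>a\<close> outside the
  two intervals, the far corner of a crossing. At most three neighbours sit at \<open>l\<close>,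
  \<open>r\<close> and \<open>m\<close>, so degree four yields an inner vertex beside
  \<open>a\<close>. This raises the degree of \<open>a\<close> to \<open>2 * k \<ge> 6\<close>, and
  then there are at least three inner vertices, at most two on either side. Two on the same side
  share their second neighbour; the other side supplies \<open>x\<close>.\<close>

lemma double_leaf:
  assumes "3 \<le> k" "a \<in> \<Union>E" "4 \<le> deg E a"
    and "uncrossed p E l (p a)" "uncrossed p E (p a) r"
    and "\<And>x. x \<in> inner_verts p E l (p a) \<Longrightarrow> deg E x \<le> 3" "\<And>x. x \<in> inner_verts p E (p a) r \<Longrightarrow> deg E x \<le> 3"
    and "\<And>u. u \<in> N a \<Longrightarrow> l \<le> p u \<and> p u \<le> r \<or> p u = m"
  obtains u x1 x2 x where "x1 \<noteq> x2" "N x1 = {u, a}" "N x2 = {u, a}" "u \<noteq> a"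
    "{a, x} \<in> E" "deg E x = 2" "x \<noteq> x1" "x \<noteq> x2"
proof -
  let ?L = "inner_verts p E l (p a)" and ?R = "inner_verts p E (p a) r"
  have finL: "finite ?L" and finR: "finite ?R" using finite_inner_verts[OF fin two] by blast+
  have L: "\<exists>y. p y = l \<and> N x = {y, a} \<and> y \<noteq> a \<and> deg E x = 2 \<and> 2 * k \<le> deg E a" if x: "x \<in> ?L" for x
  proof -
    obtain y z where yz: "p y = l" "p z = p a" "N x = {y, z}" "y \<noteq> z" "deg E x = 2" "2 * k \<le> deg E z"
      using leaf_neighbours[OF assms(1,4,6) x] by blast
    then have "z = a" using pos_eq[of z a] N_subset[of x] assms(2) by blast
    then show ?thesis using yz by blast
  qed
  have R: "\<exists>y. p y = r \<and> N x = {y, a} \<and> y \<noteq> a \<and> deg E x = 2 \<and> 2 * k \<le> deg E a" if x: "x \<in> ?R" for x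
  proof -
    obtain y z where yz: "p y = p a" "p z = r" "N x = {y, z}" "y \<noteq> z" "deg E x = 2" "2 * k \<le> deg E y"
      using leaf_neighbours[OF assms(1,5,7) x] by blast
    then have "y = a" using pos_eq[of y a] N_subset[of x] assms(2) by blast
    then show ?thesis using yz by (intro exI[of _ z]) auto
  qed
  have "N a \<subseteq> ?L \<union> ?R \<union> {w \<in> \<Union>E. p w \<in> {l, r, m}}"
  proof
    fix u assume u: "u \<in> N a"
    then have "u \<in> \<Union>E" "u \<noteq> a" using N_irrefl by blast+
    then have "p u \<noteq> p a" using pos_eq assms(2) by blast
    then show "u \<in> ?L \<union> ?R \<union> {w \<in> \<Union>E. p w \<in> {l, r, m}}"
      using assms(8)[OF u] \<open>u \<in> \<Union>E\<close> unfolding inner_verts_def by force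
  qed
  then have "card (N a) \<le> card (?L \<union> ?R \<union> {w \<in> \<Union>E. p w \<in> {l, r, m}})"
    by (rule card_mono[OF finite_UnI[OF finite_UnI[OF finL finR] finite_pos]])
  also have "\<dots> \<le> card ?L + card ?R + card {w \<in> \<Union>E. p w \<in> {l, r, m}}"
    by (meson add_le_mono1 card_Un_le order_trans)
  also have "card {w \<in> \<Union>E. p w \<in> {l, r, m}} \<le> 3"
    using card_pos[of "{l, r, m}"] by (simp add: card_insert_if split: if_splits)
  finally have le: "deg E a \<le> card ?L + card ?R + 3" unfolding deg_N by simp
  have cL: "card ?L \<le> 2" using leaf_card[OF assms(1,4,6)] .
  have cR: "card ?R \<le> 2" using leaf_card[OF assms(1,5,7)] .
  have "?L \<noteq> {} \<or> ?R \<noteq> {}" using le assms(3) by auto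
  then have "2 * k \<le> deg E a" using L R by blast
  have "3 \<le> card ?L + card ?R" using le assms(1) \<open>2 * k \<le> deg E a\<close> by linarith
  have "card ?L = 2 \<and> ?R \<noteq> {} \<or> card ?R = 2 \<and> ?L \<noteq> {}"
  proof (cases "card ?L = 2")
    case True
    then have "card ?R \<noteq> 0" using \<open>3 \<le> card ?L + card ?R\<close> by linarith
    then show ?thesis using True by auto
  next
    case False
    then have "card ?R = 2" "card ?L \<noteq> 0" using \<open>3 \<le> card ?L + card ?R\<close> cL cR by linarith+
    then show ?thesis by auto
  qed
  then consider "card ?L = 2" "?R \<noteq> {}" | "card ?R = 2" "?L \<noteq> {}" by blast
  moreover have disj: "?L \<inter> ?R = {}" unfolding inner_verts_def by auto
  ultimately show thesis
  proof cases
    case 1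
    then obtain x1 x2 x where x: "x1 \<in> ?L" "x2 \<in> ?L" "x1 \<noteq> x2" "x \<in> ?R"
      by (metis card_2_iff' ex_in_conv)
    obtain y1 y2 where y: "p y1 = l" "N x1 = {y1, a}" "y1 \<noteq> a" "p y2 = l" "N x2 = {y2, a}"
      using L x by meson
    have "y1 = y2" using y pos_eq[of y1 y2] N_subset[of x1] N_subset[of x2] by simp
    obtain y where "N x = {y, a}" "deg E x = 2" using R x by meson
    then have "{a, x} \<in> E" by (auto simp: insert_commute)
    then show ?thesis using that[of x1 x2 y1 x] x y disj \<open>y1 = y2\<close> \<open>deg E x = 2\<close> by auto
  next
    case 2
    then obtain x1 x2 x where x: "x1 \<in> ?R" "x2 \<in> ?R" "x1 \<noteq> x2" "x \<in> ?L"
      by (metis card_2_iff' ex_in_conv)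
    obtain y1 y2 where y: "p y1 = r" "N x1 = {y1, a}" "y1 \<noteq> a" "p y2 = r" "N x2 = {y2, a}"
      using R x by meson
    have "y1 = y2" using y pos_eq[of y1 y2] N_subset[of x1] N_subset[of x2] by simp
    obtain y where "N x = {y, a}" "deg E x = 2" using L x by meson
    then have "{a, x} \<in> E" by (auto simp: insert_commute)
    then show ?thesis using that[of x1 x2 y1 x] x y disj \<open>y1 = y2\<close> \<open>deg E x = 2\<close> by auto
  qed
qed

end

lemma card_2_other: "card e = 2 \<Longrightarrow> v \<in> e \<Longrightarrow> \<exists>w. e = {v, w}"
  by (metis card_2_iff insertE insert_commute singletonD)

lemma deg_remove_two:
  assumes "finite E" "F \<subseteq> E" "{u, x} \<in> E - F" "{u, y} \<in> E - F" "x \<noteq> y"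
  shows "deg F u + 2 \<le> deg E u"
proof -
  have finF: "finite F" using assms(1,2) by (rule rev_finite_subset)
  have "card {{u, x}, {u, y}} = 2" using assms(5) by (auto simp: doubleton_eq_iff)
  then have "deg F u + 2 = card ({e \<in> F. u \<in> e} \<union> {{u, x}, {u, y}})"
    using assms finF by (subst card_Un_disjoint) auto
  also have "\<dots> \<le> deg E u" using assms by (intro card_mono) auto
  finally show ?thesis .
qed

lemma inner_verts_psubset:
  assumes "a \<in> inner_verts p E i j" "i \<le> i'" "j' \<le> j" "p a \<le> i' \<or> j' \<le> p a"
  shows "inner_verts p E i' j' \<subset> inner_verts p E i j"
proof -
  have "a \<notin> inner_verts p E i' j'" using assms(4) unfolding inner_verts_def by auto
  moreover have "inner_verts p E i' j' \<subseteq> inner_verts p E i j"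
    using assms(2,3) unfolding inner_verts_def by auto
  ultimately show ?thesis using assms(1) by blast
qed

context critical
begin

text \<open>Removing the four edges frees two places at \<open>u\<close> and at \<open>a\<close> and
  leaves \<open>x1\<close> and \<open>x2\<close> uncovered, which is the situation of
  \<open>four_cycle_pendant_reducible\<close>.\<close>

lemma four_cycle_colorable:
  assumes IH: "\<And>F. F \<subset> E \<Longrightarrow> linear_colorable k F"
    and "3 \<le> k" "x1 \<noteq> x2" "N x1 = {u, a}" "N x2 = {u, a}" "u \<noteq> a" "{a, x} \<in> E" "deg E x = 2"
      "x \<noteq> x1" "x \<noteq> x2"
  shows "linear_colorable k E"
proof -
  let ?C = "{{u, x1}, {u, x2}, {a, x1}, {a, x2}}"
  let ?F = "E - ?C"
  have in1: "{x1, u} \<in> E" "{x1, a} \<in> E" and in2: "{x2, u} \<in> E" "{x2, a} \<in> E"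
    using assms(4,5) by blast+
  then have inE: "{u, x1} \<in> E" "{a, x1} \<in> E" "{u, x2} \<in> E" "{a, x2} \<in> E"
    by (simp_all add: insert_commute)
  have ne: "u \<noteq> x1" "a \<noteq> x1" "u \<noteq> x2" "a \<noteq> x2"
    using N_irrefl[of x1] N_irrefl[of x2] unfolding assms(4,5) by auto
  have xa: "x \<noteq> a" using N_irrefl[of a] assms(7) by blast
  \<comment> \<open>Being adjacent to \<open>x1\<close> of degree two, \<open>u\<close> has degree
    at least \<open>2 * k\<close>, whereas \<open>x\<close> has degree two.\<close>
  have xu: "x \<noteq> u" using light[OF in1(1)] deg_N[of x1] assms(2,4,6,8) by auto
  have free: "w \<notin> \<Union>?F" if "N w = {u, a}" "{{u, w}, {a, w}} \<subseteq> ?C" for w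
  proof
    assume "w \<in> \<Union>?F"
    then obtain e where e: "e \<in> ?F" "w \<in> e" by blast
    then have "card e = 2" using two by blast
    then obtain y where y: "e = {w, y}" using card_2_other e(2) by metis
    then have "y \<in> N w" using e by blast
    then have "y = u \<or> y = a" using that by blast
    moreover have "e = {y, w}" using y by (simp add: insert_commute)
    ultimately show False using e(1) that(2) by blast
  qed
  have "?F \<subset> E" using inE by blast
  then obtain \<phi> where \<phi>: "linear_coloring k ?F \<phi>" using IH unfolding linear_colorable_def by blast
  have "linear_colorable k (?F \<union> ?C)"
  proof (rule four_cycle_pendant_reducible[OF \<phi>, where x = x])
    show "distinct [u, a, x1, x2]" using ne assms(3,6) by simp
    show "x1 \<notin> \<Union>?F" by (rule free[OF assms(4)]) simp
    show "x2 \<notin> \<Union>?F" by (rule free[OF assms(5)]) simp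
    have "deg ?F u + 2 \<le> deg E u"
      by (rule deg_remove_two[OF fin, where x = x1 and y = x2]) (use inE assms(3) in auto)
    then show "deg ?F u + 2 \<le> 2 * k" using max_deg[of u] by simp
    have "deg ?F a + 2 \<le> deg E a"
      by (rule deg_remove_two[OF fin, where x = x1 and y = x2]) (use inE assms(3) in auto)
    then show "deg ?F a + 2 \<le> 2 * k" using max_deg[of a] by simp
    show "{a, x} \<in> ?F" using assms(6,7,9,10) ne by (auto simp: doubleton_eq_iff)
    have "deg ?F x \<le> deg E x" using fin by (intro card_mono) auto
    then show "deg ?F x \<le> 2" using assms(8) by simp
  qed fact+
  moreover have "?F \<union> ?C = E" using inE by auto
  ultimately show ?thesis by simp
qed

lemma colorable_ge_3:
  assumes "\<And>F. F \<subset> E \<Longrightarrow> linear_colorable k F" "3 \<le> k" "E \<noteq> {}"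
  shows "linear_colorable k E"
proof -
  obtain e where "e \<in> E" using assms(3) by blast
  then obtain v w where vw: "{v, w} \<in> E" using two by (metis card_2_iff)
  \<comment> \<open>Adjacent degrees sum to at least 8.\<close>
  have "4 \<le> deg E v \<or> 4 \<le> deg E w" using light[OF vw] assms(2) by linarith
  then obtain h where h: "h \<in> \<Union>E" "4 \<le> deg E h" using vw by blast
  obtain i j where ij: "uncrossed p E i j" "\<exists>x\<in>inner_verts p E i j. 4 \<le> deg E x"
    and minimal: "\<And>i' j' x. uncrossed p E i' j' \<Longrightarrow> inner_verts p E i' j' \<subset> inner_verts p E i j \<Longrightarrow>
        x \<in> inner_verts p E i' j' \<Longrightarrow> \<not> 4 \<le> deg E x"
    by (rule minimal_uncrossed[where E = E and v = h and Q = "\<lambda>x. 4 \<le> deg E x" and p = p, OF fin two h]) blast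
  have within: "i \<le> p u \<and> p u \<le> j" if "u \<in> N a" "a \<in> inner_verts p E i j" for a u
    using ij(1) that unfolding uncrossed_def inner_verts_def by blast
  have small: "deg E x \<le> 3" if "uncrossed p E i' j'" "i \<le> i'" "j' \<le> j" "a \<in> inner_verts p E i j"
      "p a \<le> i' \<or> j' \<le> p a" "x \<in> inner_verts p E i' j'" for i' j' a x
    using minimal[OF that(1) inner_verts_psubset[OF that(4,2,3,5)] that(6)] by simp
  have heavy: "x = a" if "x \<in> inner_verts p E i j" "a \<in> inner_verts p E i j" "p x = p a" for x a
    by (rule pos_eq) (use that in \<open>auto simp: inner_verts_def\<close>)
  have ne: "inner_verts p E i j \<noteq> {}" using ij(2) by blast
  from fin two one ij(1) ne show ?thesis
  proof (cases rule: uncrossed_split)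
    case (T a)
    have a: "a \<in> \<Union>E" "i < p a" "p a < j" using T(1) unfolding inner_verts_def by auto
    have L: "deg E x \<le> 3" if "x \<in> inner_verts p E i (p a)" for x
      by (rule small[OF T(2) _ _ T(1) _ that]) (use a in auto)
    have R: "deg E x \<le> 3" if "x \<in> inner_verts p E (p a) j" for x
      by (rule small[OF T(3) _ _ T(1) _ that]) (use a in auto)
    obtain x where x: "x \<in> inner_verts p E i j" "4 \<le> deg E x" using ij(2) by blast
    have "x = a"
    proof (rule ccontr)
      assume "x \<noteq> a"
      then have "p x \<noteq> p a" using heavy x(1) T(1) by blast
      then have "x \<in> inner_verts p E i (p a) \<or> x \<in> inner_verts p E (p a) j"
        using x(1) unfolding inner_verts_def by auto
      then show False using L R x(2) by force
    qed
    then have "4 \<le> deg E a" using x by simp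
    \<comment> \<open>All neighbours lie between \<open>i\<close> and \<open>j\<close> here, so the
      extra position \<open>m\<close> just repeats an end.\<close>
    have N: "i \<le> p u \<and> p u \<le> j \<or> p u = i" if "u \<in> N a" for u
      using within[OF that T(1)] by blast
    show ?thesis
      by (rule double_leaf[OF assms(2) a(1) \<open>4 \<le> deg E a\<close> T(2,3) L R, where m = i])
        (assumption, assumption, rule N, assumption, (rule four_cycle_colorable[OF assms(1,2)]; assumption))
  next
    case (X a b)
    have a: "a \<in> \<Union>E" "i < p a" "p a < j" using X(1) unfolding inner_verts_def by auto
    have b: "b \<in> \<Union>E" "i < p b" "p b < j" using X(2) unfolding inner_verts_def by auto
    have L: "deg E x \<le> 3" if "x \<in> inner_verts p E i (p a)" for x
      by (rule small[OF X(4) _ _ X(1) _ that]) (use a in auto)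
    have M: "deg E x \<le> 3" if "x \<in> inner_verts p E (p a) (p b)" for x
      by (rule small[OF X(5) _ _ X(1) _ that]) (use a b in auto)
    have R: "deg E x \<le> 3" if "x \<in> inner_verts p E (p b) j" for x
      by (rule small[OF X(6) _ _ X(2) _ that]) (use b in auto)
    obtain x where x: "x \<in> inner_verts p E i j" "4 \<le> deg E x" using ij(2) by blast
    have "x = a \<or> x = b"
    proof (rule ccontr)
      assume "\<not> (x = a \<or> x = b)"
      then have "p x \<noteq> p a" "p x \<noteq> p b" using heavy x(1) X(1,2) by blast+
      then have "x \<in> inner_verts p E i (p a) \<or> x \<in> inner_verts p E (p a) (p b) \<or> x \<in> inner_verts p E (p b) j"
        using x(1) unfolding inner_verts_def by auto
      then show False using L M R x(2) by force
    qed
    then consider "4 \<le> deg E a" | "4 \<le> deg E b" using x by blast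
    then show ?thesis
    proof cases
      case 1
      \<comment> \<open>Right of \<open>b\<close> only the position \<open>j\<close> is possible:
        the part from \<open>b\<close> to \<open>j\<close> is uncrossed, so no edge from its inside
        reaches back to \<open>a\<close>. The case of \<open>b\<close> below is the mirror
        image.\<close>
      have N: "i \<le> p u \<and> p u \<le> p b \<or> p u = j" if u: "u \<in> N a" for u
      proof (rule ccontr)
        assume n: "\<not> ?thesis"
        then have "p b < p u" "p u < j" using within[OF u X(1)] by auto
        moreover have "{u, a} \<in> E" using u by (simp add: insert_commute)
        ultimately have "p b \<le> p a" using X(6) unfolding uncrossed_def by blast
        then show False using X(3) by simp
      qed
      show ?thesis
        by (rule double_leaf[OF assms(2) a(1) 1 X(4,5) L M, where m = j])
          (assumption, assumption, rule N, assumption, (rule four_cycle_colorable[OF assms(1,2)]; assumption))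
    next
      case 2
      have N: "p a \<le> p u \<and> p u \<le> j \<or> p u = i" if u: "u \<in> N b" for u
      proof (rule ccontr)
        assume n: "\<not> ?thesis"
        then have "i < p u" "p u < p a" using within[OF u X(2)] by auto
        moreover have "{u, b} \<in> E" using u by (simp add: insert_commute)
        ultimately have "p b \<le> p a" using X(4) unfolding uncrossed_def by blast
        then show False using X(3) by simp
      qed
      show ?thesis
        by (rule double_leaf[OF assms(2) b(1) 2 X(5,6) M R, where m = i])
          (assumption, assumption, rule N, assumption, (rule four_cycle_colorable[OF assms(1,2)]; assumption))
    qed
  qed
qed

text \<open>In a smallest interval the parts of a split have no inner vertices. A single splitting
  vertex would have neighbours only at the two ends, too few for degree three. In the crossing case
  \<open>a\<close> and \<open>b\<close> each have just three places left for their neighbours and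
  must use all of them.\<close>

lemma colorable_2:
  assumes IH: "\<And>F. F \<subset> E \<Longrightarrow> linear_colorable k F"
    and k: "k = 2" and deg3: "\<And>v. deg E v \<le> 3" and "E \<noteq> {}"
  shows "linear_colorable k E"
proof -
  have cubic: "card (N v) = 3" if "v \<in> \<Union>E" for v
  proof -
    obtain e where e: "e \<in> E" "v \<in> e" using \<open>v \<in> \<Union>E\<close> by blast
    then obtain w where "{v, w} \<in> E" using two card_2_other[of e v] by metis
    then have "6 \<le> deg E v + deg E w" using light k by fastforce
    then show ?thesis using deg3[of v] deg3[of w] deg_N[of v] by linarith
  qed
  \<comment> \<open>Three neighbours confined to three positions fill them: each position carries a
    neighbour, and every vertex found there is one.\<close>
  have N_eq: "N v = {w \<in> \<Union>E. p w \<in> {x, y, z}} \<and> (\<forall>t\<in>{x, y, z}. \<exists>w. w \<in> N v \<and> p w = t)"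
    if "v \<in> \<Union>E" "N v \<subseteq> {w \<in> \<Union>E. p w \<in> {x, y, z}}" for v x y z
  proof -
    have le: "card {w \<in> \<Union>E. p w \<in> {x, y, z}} \<le> card {x, y, z}" by (rule card_pos) simp
    have "card {x, y, z} \<le> 3" by (simp add: card_insert_if)
    then have "card {w \<in> \<Union>E. p w \<in> {x, y, z}} \<le> card (N v)" using le cubic[OF that(1)] by linarith
    then have eq: "N v = {w \<in> \<Union>E. p w \<in> {x, y, z}}"
      by (rule card_seteq[OF finite_pos that(2)])
    have "inj_on p (N v)" using one N_subset unfolding one_crossing_def by (meson inj_on_subset)
    then have "card (p ` N v) = 3" using cubic[OF that(1)] by (simp add: card_image)
    moreover have "p ` N v \<subseteq> {x, y, z}" using that(2) by blast
    ultimately have "p ` N v = {x, y, z}"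
      using \<open>card {x, y, z} \<le> 3\<close> by (intro card_seteq) auto
    then have "\<exists>w. w \<in> N v \<and> p w = t" if "t \<in> {x, y, z}" for t
    proof -
      have "t \<in> p ` N v" using \<open>p ` N v = {x, y, z}\<close> that by simp
      then show ?thesis by blast
    qed
    then show ?thesis using eq by simp
  qed
  obtain e where e: "e \<in> E" using \<open>E \<noteq> {}\<close> by blast
  then have "e \<noteq> {}" using two by force
  then obtain v where v: "v \<in> \<Union>E" using e by blast
  obtain i j where ij: "uncrossed p E i j" "\<exists>x\<in>inner_verts p E i j. True"
    and minimal: "\<And>i' j' x. uncrossed p E i' j' \<Longrightarrow> inner_verts p E i' j' \<subset> inner_verts p E i j \<Longrightarrow>
        x \<in> inner_verts p E i' j' \<Longrightarrow> \<not> True"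
    by (rule minimal_uncrossed[where E = E and v = v and Q = "\<lambda>x. True" and p = p, OF fin two v TrueI]) blast
  have ne: "inner_verts p E i j \<noteq> {}" using ij(2) by blast
  have within: "i \<le> p u \<and> p u \<le> j" if "u \<in> N a" "a \<in> inner_verts p E i j" for a u
    using ij(1) that unfolding uncrossed_def inner_verts_def by blast
  have none: "x \<notin> inner_verts p E i' j'" if "uncrossed p E i' j'" "i \<le> i'" "j' \<le> j" "a \<in> inner_verts p E i j"
      "p a \<le> i' \<or> j' \<le> p a" for i' j' a x
    using minimal[OF that(1) inner_verts_psubset[OF that(4,2,3,5)]] by blast
  have V: "w \<in> \<Union>E \<and> w \<noteq> a \<and> (a \<in> \<Union>E \<longrightarrow> p w \<noteq> p a)" if "w \<in> N a" for w a
  proof -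
    have "w \<in> \<Union>E" "w \<noteq> a" using that N_irrefl by blast+
    then show ?thesis using pos_eq[of w a] by blast
  qed
  from fin two one ij(1) ne show ?thesis
  proof (cases rule: uncrossed_split)
    case (T a)
    have a: "a \<in> \<Union>E" "i < p a" "p a < j" using T(1) unfolding inner_verts_def by auto
    have "N a \<subseteq> {w \<in> \<Union>E. p w \<in> {i, j}}"
    proof
      fix w assume w: "w \<in> N a"
      have "w \<notin> inner_verts p E i (p a)" by (rule none[OF T(2) _ _ T(1)]) (use a in auto)
      moreover have "w \<notin> inner_verts p E (p a) j" by (rule none[OF T(3) _ _ T(1)]) (use a in auto)
      ultimately show "w \<in> {w \<in> \<Union>E. p w \<in> {i, j}}"
        using V[OF w] a(1) within[OF w T(1)] unfolding inner_verts_def by auto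
    qed
    then have "card (N a) \<le> card {w \<in> \<Union>E. p w \<in> {i, j}}" by (rule card_mono[OF finite_pos])
    also have "\<dots> \<le> card {i, j}" by (rule card_pos) simp
    also have "\<dots> \<le> 2" by (simp add: card_insert_if)
    finally show ?thesis using cubic[OF a(1)] by simp
  next
    case (X a b)
    have a: "a \<in> \<Union>E" "i < p a" "p a < j" using X(1) unfolding inner_verts_def by auto
    have b: "b \<in> \<Union>E" "i < p b" "p b < j" using X(2) unfolding inner_verts_def by auto
    have L: "w \<notin> inner_verts p E i (p a)" for w by (rule none[OF X(4) _ _ X(1)]) (use a in auto)
    have M: "w \<notin> inner_verts p E (p a) (p b)" for w by (rule none[OF X(5) _ _ X(1)]) (use a b in auto)
    have R: "w \<notin> inner_verts p E (p b) j" for w by (rule none[OF X(6) _ _ X(2)]) (use b in auto)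
    have out: "p w = i \<or> p w = p a \<or> p w = p b \<or> p w = j" if "w \<in> \<Union>E" "i \<le> p w" "p w \<le> j" for w
      using L[of w] M[of w] R[of w] that unfolding inner_verts_def by auto
    have "N a \<subseteq> {w \<in> \<Union>E. p w \<in> {i, p b, j}}"
    proof
      fix w assume w: "w \<in> N a"
      have "p w = i \<or> p w = p a \<or> p w = p b \<or> p w = j"
        using out[of w] V[OF w] within[OF w X(1)] by simp
      then show "w \<in> {w \<in> \<Union>E. p w \<in> {i, p b, j}}" using V[OF w] a(1) by simp
    qed
    note Na = N_eq[OF a(1) this]
    have "N b \<subseteq> {w \<in> \<Union>E. p w \<in> {i, p a, j}}"
    proof
      fix w assume w: "w \<in> N b"
      have "p w = i \<or> p w = p a \<or> p w = p b \<or> p w = j"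
        using out[of w] V[OF w] within[OF w X(2)] by simp
      then show "w \<in> {w \<in> \<Union>E. p w \<in> {i, p a, j}}" using V[OF w] b(1) by simp
    qed
    note Nb = N_eq[OF b(1) this]
    obtain y z where yz: "y \<in> N a" "p y = i" "z \<in> N a" "p z = j" using Na by blast
    have yz_in: "y \<in> \<Union>E" "z \<in> \<Union>E" using V yz by blast+
    have "b \<in> N a" using Na b(1) by blast
    have "y \<in> N b" "z \<in> N b" using Nb yz yz_in by blast+
    have Na': "N a = {y, z, b}" and Nb': "N b = {y, z, a}"
      using Na Nb yz yz_in a(1) b(1) pos_eq by blast+
    have dist: "distinct [y, z, a, b]" using yz a b X(3) by auto
    let ?C = "{{a, b}, {y, a}, {y, b}, {z, a}, {z, b}}"
    let ?F = "E - ?C"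
    have inE: "{a, b} \<in> E" "{a, y} \<in> E" "{b, y} \<in> E" "{a, z} \<in> E" "{b, z} \<in> E"
      using yz \<open>b \<in> N a\<close> \<open>y \<in> N b\<close> \<open>z \<in> N b\<close> by blast+
    then have inE': "{y, a} \<in> E" "{y, b} \<in> E" "{z, a} \<in> E" "{z, b} \<in> E"
      by (simp_all add: insert_commute)
    have free: "w \<notin> \<Union>?F" if "\<And>y. y \<in> N w \<Longrightarrow> {w, y} \<in> ?C" for w
    proof
      assume "w \<in> \<Union>?F"
      then obtain e where e: "e \<in> ?F" "w \<in> e" by blast
      then have "card e = 2" using two by blast
      then obtain y where y: "e = {w, y}" using card_2_other e(2) by metis
      then have "y \<in> N w" using e by blast
      then have "e \<in> ?C" unfolding y by (rule that)
      then show False using e(1) by blast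
    qed
    have "?F \<subset> E" using inE by blast
    then obtain \<phi> where \<phi>: "linear_coloring 2 ?F \<phi>" using IH k unfolding linear_colorable_def by blast
    have "linear_colorable 2 (?F \<union> ?C)"
    proof (rule cubic_reducible[OF \<phi> dist])
      show "a \<notin> \<Union>?F" by (rule free) (unfold Na', auto simp: doubleton_eq_iff)
      show "b \<notin> \<Union>?F" by (rule free) (unfold Nb', auto simp: doubleton_eq_iff)
      have "deg ?F y + 2 \<le> deg E y"
        by (rule deg_remove_two[OF fin, where x = a and y = b]) (use inE' dist in auto)
      then show "deg ?F y \<le> 1" using deg3[of y] by simp
      have "deg ?F z + 2 \<le> deg E z"
        by (rule deg_remove_two[OF fin, where x = a and y = b]) (use inE' dist in auto)
      then show "deg ?F z \<le> 1" using deg3[of z] by simp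
    qed
    moreover have "?F \<union> ?C = E" using inE inE' by auto
    ultimately show ?thesis using k by simp
  qed
qed

end

text \<open>Here \<open>k\<close> is fixed and the degrees are only bounded, so the hypotheses pass
  to subsets of the edges and a minimal counterexample makes sense.\<close>

theorem one_crossing_linear_colorable:
  assumes "finite E" "\<forall>e\<in>E. card e = 2" "one_crossing p E"
    and "3 \<le> k \<and> (\<forall>v. deg E v \<le> 2 * k) \<or> k = 2 \<and> (\<forall>v. deg E v \<le> 3)"
  shows "linear_colorable k E"
  using assms
proof (induction E rule: finite_psubset_induct)
  case (psubset E)
  have mono: "deg F v \<le> deg E v" if "F \<subseteq> E" for F v
    using psubset.hyps that by (intro card_mono) auto
  have IH: "linear_colorable k F" if "F \<subset> E" for F
  proof (rule psubset.IH[OF that])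
    show "\<forall>e\<in>F. card e = 2" using that psubset.prems(1) by blast
    show "one_crossing p F" using that psubset.prems(2) one_crossing_subset by blast
    show "3 \<le> k \<and> (\<forall>v. deg F v \<le> 2 * k) \<or> k = 2 \<and> (\<forall>v. deg F v \<le> 3)"
      using psubset.prems(3) mono[of F] that by (meson order_trans psubset_imp_subset)
  qed
  show ?case
  proof (cases "E = {} \<or> (\<exists>u v. {u, v} \<in> E \<and> deg E u + deg E v \<le> 2 * k + 1)")
    case True
    then show ?thesis
    proof
      assume "E = {}"
      then have "linear_coloring k E (\<lambda>_. 0)"
        unfolding linear_coloring_def by (auto intro: path_forest.empty)
      then show ?thesis unfolding linear_colorable_def by blast
    next
      assume "\<exists>u v. {u, v} \<in> E \<and> deg E u + deg E v \<le> 2 * k + 1"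
      then obtain u v where uv: "{u, v} \<in> E" "deg E u + deg E v \<le> 2 * k + 1" by blast
      have "u \<noteq> v" using uv(1) psubset.prems(1) by force
      moreover have "linear_colorable k (E - {{u, v}})" using uv(1) by (intro IH) auto
      ultimately show ?thesis using light_edge_reducible[OF _ psubset.hyps uv(1) _ uv(2)] by blast
    qed
  next
    case False
    have "critical p E k"
    proof
      show "deg E v \<le> 2 * k" for v using psubset.prems(3) by (auto intro: order_trans)
      show "2 * k + 2 \<le> deg E u + deg E v" if "{u, v} \<in> E" for u v
      proof -
        have "\<not> deg E u + deg E v \<le> 2 * k + 1" using False that by blast
        then show ?thesis by linarith
      qed
    qed (use psubset in auto)
    then interpret critical p E k .
    have "E \<noteq> {}" using False by blast
    then show ?thesis using psubset.prems(3) colorable_ge_3[OF IH] colorable_2[OF IH] by blast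
  qed
qed

section \<open>Gluing arrangements\<close>

lemma one_crossing_mono:
  assumes "one_crossing p E" "inj_on q (\<Union>E)"
    and "\<And>e f. e \<in> E \<Longrightarrow> f \<in> E \<Longrightarrow> pos_crosses q e f \<Longrightarrow> pos_crosses p e f"
  shows "one_crossing q E"
  using assms unfolding one_crossing_def by blast

text \<open>Interleaving depends only on the cyclic order. Vertices left of \<open>v\<close> are
  shifted by \<open>M\<close>, which exceeds the spread of all positions. If \<open>v\<close> is
  uncovered, the cut \<open>t\<close> lies left of every vertex and the order is unchanged.\<close>

lemma one_crossing_rotate:
  assumes "finite E" "\<forall>e\<in>E. card e = 2" "one_crossing p E"
  obtains q where "one_crossing q E" "q v = 0" "\<And>x. x \<in> \<Union>E \<Longrightarrow> x \<noteq> v \<Longrightarrow> 0 < q x"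
proof -
  have fin: "finite (p ` \<Union>E)" using finite_Union_card_2[OF assms(1,2)] by simp
  have inj: "p x \<noteq> p y" if "x \<in> \<Union>E" "y \<in> \<Union>E" "x \<noteq> y" for x y
    using assms(3) that unfolding one_crossing_def by (auto dest: inj_onD)
  define l where "l = Min (p ` \<Union>E)"
  define M where "M = Max (p ` \<Union>E) - l + 1"
  have range: "l \<le> p x" "p x < l + M" if "x \<in> \<Union>E" for x
  proof -
    have "Min (p ` \<Union>E) \<le> p x" "p x \<le> Max (p ` \<Union>E)" using that fin by auto
    then show "l \<le> p x" "p x < l + M" unfolding l_def M_def by linarith+
  qed
  define t where "t = (if v \<in> \<Union>E then p v else l - 1)"
  define q where "q x = (if x = v then 0 else if t \<le> p x then p x - t else p x - t + M)" for x
  have q: "q x = (if t \<le> p x then p x - t else p x - t + M)" if "x \<in> \<Union>E" for x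
    unfolding q_def t_def using that by auto
  have less: "q x < q y \<longleftrightarrow> (p x < t \<and> p y < t \<or> t \<le> p x \<and> t \<le> p y) \<and> p x < p y \<or> t \<le> p x \<and> p y < t"
    if "x \<in> \<Union>E" "y \<in> \<Union>E" for x y
    using range[OF that(1)] range[OF that(2)] q[OF that(1)] q[OF that(2)] by (auto split: if_splits)
  have "inj_on q (\<Union>E)"
  proof (rule inj_onI, rule ccontr)
    fix x y assume "x \<in> \<Union>E" "y \<in> \<Union>E" "q x = q y" "x \<noteq> y"
    then show False using inj[of x y] less[of x y] less[of y x] by linarith
  qed
  moreover have "pos_crosses p e f" if efE: "e \<in> E" "f \<in> E" "pos_crosses q e f" for e f
  proof -
    obtain a b c d where abcd: "q a < q b" "q b < q c" "q c < q d"
      and ef: "{a, c} = e \<and> {b, d} = f \<or> {a, c} = f \<and> {b, d} = e"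
      using efE(3) unfolding pos_crosses_def by blast
    have V: "a \<in> \<Union>E" "b \<in> \<Union>E" "c \<in> \<Union>E" "d \<in> \<Union>E" using ef efE(1,2) by blast+
    \<comment> \<open>These are the four cyclic shifts of the order \<open>a\<close>,
      \<open>b\<close>, \<open>c\<close>, \<open>d\<close>; in each of them the same two pairs
      interleave.\<close>
    have "p a < p b \<and> p b < p c \<and> p c < p d \<or> p d < p a \<and> p a < p b \<and> p b < p c
      \<or> p c < p d \<and> p d < p a \<and> p a < p b \<or> p b < p c \<and> p c < p d \<and> p d < p a"
      using abcd unfolding less[OF V(1,2)] less[OF V(2,3)] less[OF V(3,4)] by linarith
    then show ?thesis using ef by (elim disjE conjE) (auto intro: pos_crossesI)
  qed
  ultimately have "one_crossing q E" by (rule one_crossing_mono[OF assms(3)])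
  moreover have "0 < q x" if "x \<in> \<Union>E" "x \<noteq> v" for x
  proof -
    have "p x \<noteq> t"
    proof (cases "v \<in> \<Union>E")
      case True
      then show ?thesis using inj[OF that(1) True that(2)] unfolding t_def by simp
    next
      case False
      then show ?thesis using range(1)[OF that(1)] unfolding t_def by simp
    qed
    moreover have "t < l + M" unfolding t_def using range[OF that(1)] range(2)[of v] by (cases "v \<in> \<Union>E") auto
    ultimately show ?thesis using q[OF that(1)] range[OF that(1)] by (auto split: if_splits)
  qed
  ultimately show thesis using that[of q] by (simp add: q_def)
qed

text \<open>Both arrangements are rotated to start at \<open>v\<close>, and the second is reflected.
  Then edges of different sets lie on opposite sides of \<open>v\<close> and cannot
  interleave.\<close>

lemma one_crossing_glue:
  assumes "finite E1" "\<forall>e\<in>E1. card e = 2" "one_crossing p1 E1"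
    and "finite E2" "\<forall>e\<in>E2. card e = 2" "one_crossing p2 E2" "\<Union>E1 \<inter> \<Union>E2 \<subseteq> {v}"
  shows "\<exists>p. one_crossing p (E1 \<union> E2)"
proof -
  obtain q1 where q1: "one_crossing q1 E1" "q1 v = 0" "\<And>x. x \<in> \<Union>E1 \<Longrightarrow> x \<noteq> v \<Longrightarrow> 0 < q1 x"
    using one_crossing_rotate[OF assms(1-3)] by metis
  obtain q2 where q2: "one_crossing q2 E2" "q2 v = 0" "\<And>x. x \<in> \<Union>E2 \<Longrightarrow> x \<noteq> v \<Longrightarrow> 0 < q2 x"
    using one_crossing_rotate[OF assms(4-6)] by metis
  define p where "p x = (if x \<in> \<Union>E1 then q1 x else - q2 x)" for x
  have p1: "p x = q1 x" if "x \<in> \<Union>E1" for x using that unfolding p_def by simp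
  have p2: "p x = - q2 x" if "x \<in> \<Union>E2" for x
    using that assms(7) q1(2) q2(2) unfolding p_def by auto
  have nonneg: "0 \<le> p x" if "x \<in> \<Union>E1" for x
    using p1[OF that] q1(2) q1(3)[OF that] by (cases "x = v") auto
  have nonpos: "p x \<le> 0" if "x \<in> \<Union>E2" for x
    using p2[OF that] q2(2) q2(3)[OF that] by (cases "x = v") auto
  have inj1: "x = y" if "x \<in> \<Union>E1" "y \<in> \<Union>E1" "q1 x = q1 y" for x y
    using q1(1) that unfolding one_crossing_def by (auto dest: inj_onD)
  have inj2: "x = y" if "x \<in> \<Union>E2" "y \<in> \<Union>E2" "q2 x = q2 y" for x y
    using q2(1) that unfolding one_crossing_def by (auto dest: inj_onD)
  have inj12: "x = y" if "x \<in> \<Union>E1" "y \<in> \<Union>E2" "p x = p y" for x y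
  proof -
    have "p x = 0" "p y = 0" using nonneg[OF that(1)] nonpos[OF that(2)] that(3) by linarith+
    then have "q1 x = 0" "q2 y = 0" using p1[OF that(1)] p2[OF that(2)] by simp_all
    then have "x = v" "y = v" using q1(3)[OF that(1)] q2(3)[OF that(2)] by force+
    then show ?thesis by simp
  qed
  have inj: "inj_on p (\<Union>(E1 \<union> E2))"
  proof (rule inj_onI)
    fix x y assume xy: "x \<in> \<Union>(E1 \<union> E2)" "y \<in> \<Union>(E1 \<union> E2)" "p x = p y"
    then consider "x \<in> \<Union>E1" "y \<in> \<Union>E1" | "x \<in> \<Union>E2" "y \<in> \<Union>E2" | "x \<in> \<Union>E1" "y \<in> \<Union>E2" | "x \<in> \<Union>E2" "y \<in> \<Union>E1"
      by blast
    then show "x = y"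
    proof cases
      case 1 then show ?thesis using inj1 p1 xy(3) by simp
    next
      case 2 then show ?thesis using inj2 p2 xy(3) by simp
    next
      case 3 then show ?thesis using inj12 xy(3) by blast
    next
      case 4 then show ?thesis using inj12[of y x] xy(3) by simp
    qed
  qed
  have cross: "(e \<in> E1 \<and> f \<in> E1 \<and> pos_crosses q1 e f) \<or> (e \<in> E2 \<and> f \<in> E2 \<and> pos_crosses q2 e f)"
    if ef: "e \<in> E1 \<union> E2" "f \<in> E1 \<union> E2" "pos_crosses p e f" for e f
  proof -
    obtain a b c d where abcd: "p a < p b" "p b < p c" "p c < p d"
      and acbd: "{a, c} = e \<and> {b, d} = f \<or> {a, c} = f \<and> {b, d} = e"
      using ef(3) unfolding pos_crosses_def by blast
    consider "{a, c} \<in> E1" "{b, d} \<in> E1" | "{a, c} \<in> E2" "{b, d} \<in> E2" | "{a, c} \<in> E1" "{b, d} \<in> E2"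
      | "{a, c} \<in> E2" "{b, d} \<in> E1" using ef(1,2) acbd by blast
    then show ?thesis
    proof cases
      case 1
      then have "p a = q1 a" "p b = q1 b" "p c = q1 c" "p d = q1 d" using p1 by blast+
      then have "pos_crosses q1 {a, c} {b, d}" "pos_crosses q1 {b, d} {a, c}"
        using abcd by (auto intro: pos_crossesI)
      then show ?thesis using acbd 1 by metis
    next
      case 2
      then have "p a = - q2 a" "p b = - q2 b" "p c = - q2 c" "p d = - q2 d" using p2 by blast+
      then have "q2 d < q2 c" "q2 c < q2 b" "q2 b < q2 a" using abcd by linarith+
      then have "pos_crosses q2 {a, c} {b, d}" "pos_crosses q2 {b, d} {a, c}"
        by (auto intro: pos_crossesI)
      then show ?thesis using acbd 2 by metis
    next
      case 3
      then have "0 \<le> p a" "p b \<le> 0" using nonneg nonpos by blast+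
      then show ?thesis using abcd by simp
    next
      case 4
      then have "0 \<le> p b" "p c \<le> 0" using nonneg nonpos by blast+
      then show ?thesis using abcd by simp
    qed
  qed
  have "f = g" if "e \<in> E1 \<union> E2" "f \<in> E1 \<union> E2" "g \<in> E1 \<union> E2" "pos_crosses p e f" "pos_crosses p e g" for e f g
  proof -
    have disj: False if "e \<in> E1" "e \<in> E2" for e
    proof -
      have "card e = 2" using that assms(2) by blast
      moreover have "e \<subseteq> {v}" using that assms(7) by blast
      ultimately show False using card_mono[of "{v}" e] by simp
    qed
    have u1: "f = g" if "e \<in> E1" "f \<in> E1" "g \<in> E1" "pos_crosses q1 e f" "pos_crosses q1 e g"
      using q1(1) that unfolding one_crossing_def by blast
    have u2: "f = g" if "e \<in> E2" "f \<in> E2" "g \<in> E2" "pos_crosses q2 e f" "pos_crosses q2 e g"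
      using q2(1) that unfolding one_crossing_def by blast
    from cross[OF that(1,2,4)] cross[OF that(1,3,5)] show ?thesis
      using disj[of e] u1 u2 by (elim disjE conjE) simp_all
  qed
  with inj have "one_crossing p (E1 \<union> E2)" unfolding one_crossing_def by blast
  then show ?thesis by blast
qed

section \<open>From two-connected subgraphs to the whole graph\<close>

lemma subgraph_trans: "subgraph K H \<Longrightarrow> subgraph H G \<Longrightarrow> subgraph K G"
  unfolding subgraph_def by auto

text \<open>Among the subgraphs above \<open>H\<close> with property \<open>P\<close>, one with the
  most vertices and edges in total is maximal. This provides both the block around a two-connected
  subgraph and the component around a connected one.\<close>

lemma maximal_subgraph_exists:
  assumes "simple_graph G" "subgraph H G" "P H"
  obtains K where "maximal_subgraph P K G" "subgraph H K"
proof -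
  have finV: "finite (verts G)" using assms(1) unfolding simple_graph_def by simp
  have finE: "finite (edges G)"
    by (rule finite_subset[of _ "Pow (verts G)"]) (use assms(1) finV in \<open>auto simp: simple_graph_def\<close>)
  define size where "size K = card (verts K) + card (edges K)" for K :: "'a graph"
  have bound: "size K \<le> size G" if "subgraph K G" for K
    unfolding size_def using that finV finE unfolding subgraph_def by (intro add_mono card_mono) auto
  let ?Q = "\<lambda>K. subgraph H K \<and> subgraph K G \<and> P K"
  have "?Q H" using assms(2,3) unfolding subgraph_def by auto
  then obtain K where K: "?Q K" and max: "\<And>L. ?Q L \<Longrightarrow> size L \<le> size K"
    using ex_has_greatest_nat[of ?Q H size "Suc (size G)"] bound by (metis less_Suc_eq_le)
  have "L = K" if L: "subgraph L G" "P L" "subgraph K L" for L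
  proof -
    have "size L \<le> size K" using max[of L] L K subgraph_trans by blast
    have fin: "finite (verts L)" "finite (edges L)"
      using L(1) finV finE finite_subset unfolding subgraph_def by auto
    have sub: "verts K \<subseteq> verts L" "edges K \<subseteq> edges L" using L(3) unfolding subgraph_def by auto
    have "card (verts K) \<le> card (verts L)" "card (edges K) \<le> card (edges L)"
      using fin sub by (auto intro: card_mono)
    then have "card (verts K) = card (verts L)" "card (edges K) = card (edges L)"
      using \<open>size L \<le> size K\<close> unfolding size_def by linarith+
    then have "verts K = verts L" "edges K = edges L" using fin sub card_subset_eq by blast+
    then show ?thesis by (simp add: prod_eq_iff)
  qed
  then show thesis using that[of K] K unfolding maximal_subgraph_def by blast
qed

lemma not_connected_separation:
  assumes "\<not> connected_graph H" "verts H \<noteq> {}" "\<forall>e\<in>edges H. e \<subseteq> verts H \<and> card e = 2"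
  obtains R where "R \<subset> verts H" "R \<noteq> {}" "\<And>e. e \<in> edges H \<Longrightarrow> e \<subseteq> R \<or> e \<inter> R = {}"
proof -
  obtain x y where xy: "x \<in> verts H" "y \<in> verts H" "(x, y) \<notin> (adjacency H)\<^sup>*"
    using assms(1,2) unfolding connected_graph_def by blast
  define R where "R = {w \<in> verts H. (x, w) \<in> (adjacency H)\<^sup>*}"
  have "e \<subseteq> R \<or> e \<inter> R = {}" if e: "e \<in> edges H" for e
  proof -
    obtain s t where st: "e = {s, t}" using assms(3) e by (metis card_2_iff)
    have V: "s \<in> verts H" "t \<in> verts H" using assms(3) e st by auto
    have "(s, t) \<in> adjacency H" "(t, s) \<in> adjacency H"
      using e st unfolding adjacency_def by (auto simp: insert_commute)
    then have "s \<in> R \<longleftrightarrow> t \<in> R" using V unfolding R_def by (auto intro: rtrancl_into_rtrancl)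
    then show ?thesis using st by auto
  qed
  moreover have "x \<in> R" "y \<notin> R" "R \<subseteq> verts H" using xy unfolding R_def by auto
  ultimately show thesis using that[of R] xy(2) by blast
qed

text \<open>Induction on the number of vertices replaces the tree of blocks: a graph on three or
  more vertices that is not two-connected splits into two smaller induced subgraphs sharing at most
  one vertex. The hypothesis speaks of all two-connected subgraphs, not of maximal ones, so that the
  parts inherit it.\<close>

theorem one_crossing_if_two_connected:
  assumes "simple_graph G"
    and "\<And>H. subgraph H G \<Longrightarrow> two_connected H \<Longrightarrow> \<exists>p. one_crossing p (edges H)"
  shows "\<exists>p. one_crossing p (edges G)"
  using assms
proof (induction "card (verts G)" arbitrary: G rule: less_induct)
  case less
  define V where "V = verts G"
  define E where "E = edges G"
  have G: "G = (V, E)" unfolding V_def E_def by simp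
  have finV: "finite V" and E: "\<forall>e\<in>E. e \<subseteq> V \<and> card e = 2"
    using less.prems(1) unfolding simple_graph_def V_def E_def by auto
  have finE: "finite E" by (rule finite_subset[of _ "Pow V"]) (use E finV in auto)
  have split: ?case if V12: "V1 \<subset> V" "V2 \<subset> V" "V1 \<inter> V2 \<subseteq> {v}" "\<And>e. e \<in> E \<Longrightarrow> e \<subseteq> V1 \<or> e \<subseteq> V2" for V1 V2 v
  proof -
    have part: "\<exists>p. one_crossing p {e \<in> E. e \<subseteq> W}" if "W \<subset> V" for W
    proof -
      let ?H = "(W, {e \<in> E. e \<subseteq> W})"
      have "card (verts ?H) < card (verts G)" using that finV by (simp add: V_def[symmetric] psubset_card_mono)
      moreover have simple: "simple_graph ?H"
        using that E finV by (auto simp: simple_graph_def intro: finite_subset)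
      moreover have "subgraph ?H G" unfolding subgraph_def G using simple that by auto
      then have "\<exists>p. one_crossing p (edges K)" if "subgraph K ?H" "two_connected K" for K
        using less.prems(2)[OF _ that(2)] subgraph_trans[OF that(1)] by blast
      ultimately show ?thesis using less.hyps[of ?H] by simp
    qed
    obtain p1 p2 where p: "one_crossing p1 {e \<in> E. e \<subseteq> V1}" "one_crossing p2 {e \<in> E. e \<subseteq> V2}"
      using part[OF V12(1)] part[OF V12(2)] by blast
    have "\<exists>p. one_crossing p ({e \<in> E. e \<subseteq> V1} \<union> {e \<in> E. e \<subseteq> V2})"
    proof (rule one_crossing_glue[OF _ _ p(1) _ _ p(2)])
      show "\<Union>{e \<in> E. e \<subseteq> V1} \<inter> \<Union>{e \<in> E. e \<subseteq> V2} \<subseteq> {v}" using V12(3) by blast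
    qed (use finE E in auto)
    moreover have "{e \<in> E. e \<subseteq> V1} \<union> {e \<in> E. e \<subseteq> V2} = E" using V12(4) by blast
    ultimately show ?thesis unfolding E_def by simp
  qed
  consider "card V < 3" | "3 \<le> card V" "\<not> connected_graph G"
    | v where "3 \<le> card V" "v \<in> V" "\<not> connected_graph (delete_vertex G v)" | "two_connected G"
    unfolding two_connected_def V_def by force
  then show ?case
  proof cases
    case 1
    \<comment> \<open>With fewer than three vertices nothing can interleave, so any injection into
      the reals serves.\<close>
    obtain f :: "'a \<Rightarrow> nat" where f: "inj_on f V" using finV finite_imp_inj_to_nat_seg by blast
    define p where "p x = real (f x)" for x
    have "inj_on p V" using f unfolding p_def inj_on_def by simp
    moreover have "\<Union>E \<subseteq> V" using E by blast
    ultimately have inj: "inj_on p (\<Union>E)" by (rule inj_on_subset)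
    have "\<not> pos_crosses p e g" if eg: "e \<in> E" "g \<in> E" for e g
    proof
      assume "pos_crosses p e g"
      then obtain a b c d where abcd: "p a < p b" "p b < p c" "p c < p d"
        and "{a, c} = e \<and> {b, d} = g \<or> {a, c} = g \<and> {b, d} = e"
        unfolding pos_crosses_def by blast
      then have "{a, c} \<in> E" "{b, d} \<in> E" using eg by auto
      then have "{a, b, c} \<subseteq> V" using E by blast
      then have "card {a, b, c} \<le> card V" using finV by (rule card_mono[rotated])
      moreover have "a \<noteq> b" "a \<noteq> c" "b \<noteq> c" using abcd by auto
      ultimately show False using 1 by simp
    qed
    with inj have "one_crossing p E" unfolding one_crossing_def by blast
    then show ?thesis unfolding E_def by blast
  next
    case 2
    then have "verts G \<noteq> {}" unfolding V_def by auto
    moreover have "\<forall>e\<in>edges G. e \<subseteq> verts G \<and> card e = 2" using E unfolding V_def E_def .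
    ultimately obtain R where "R \<subset> verts G" "R \<noteq> {}" "\<And>e. e \<in> edges G \<Longrightarrow> e \<subseteq> R \<or> e \<inter> R = {}"
      by (rule not_connected_separation[OF 2(2)]) blast
    then have R: "R \<subset> V" "R \<noteq> {}" "\<And>e. e \<in> E \<Longrightarrow> e \<subseteq> R \<or> e \<inter> R = {}"
      unfolding V_def E_def by blast+
    show ?thesis
    \<comment> \<open>The two parts are disjoint, so any value of \<open>v\<close> will do.\<close>
    proof (rule split[where v = undefined and ?V1.0 = R and ?V2.0 = "V - R"])
      show "V - R \<subset> V" using R by blast
      show "e \<subseteq> R \<or> e \<subseteq> V - R" if "e \<in> E" for e using R(3)[OF that] E that by blast
    qed (use R in auto)
  next
    case (3 v)
    let ?H = "delete_vertex G v"
    have H: "verts ?H = V - {v}" "edges ?H = {e \<in> E. v \<notin> e}" unfolding delete_vertex_def V_def E_def by auto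
    have "V - {v} \<noteq> {}"
    proof
      assume "V - {v} = {}"
      then have "card V \<le> card {v}" by (intro card_mono) auto
      then show False using 3(1) by simp
    qed
    then have "verts ?H \<noteq> {}" using H by simp
    moreover have "\<forall>e\<in>edges ?H. e \<subseteq> verts ?H \<and> card e = 2" unfolding H using E by auto
    ultimately obtain R where "R \<subset> verts ?H" "R \<noteq> {}" "\<And>e. e \<in> edges ?H \<Longrightarrow> e \<subseteq> R \<or> e \<inter> R = {}"
      by (rule not_connected_separation[OF 3(3)]) blast
    then have R: "R \<subset> V - {v}" "R \<noteq> {}" "\<And>e. e \<in> E \<Longrightarrow> v \<notin> e \<Longrightarrow> e \<subseteq> R \<or> e \<inter> R = {}"
      unfolding H by blast+
    show ?thesis
    proof (rule split[where v = v and ?V1.0 = "insert v R" and ?V2.0 = "V - R"])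
      show "insert v R \<subset> V" using R(1) 3(2) by blast
      show "V - R \<subset> V" using R by blast
      show "insert v R \<inter> (V - R) \<subseteq> {v}" by blast
      show "e \<subseteq> insert v R \<or> e \<subseteq> V - R" if e: "e \<in> E" for e
      proof (cases "v \<in> e")
        case True
        then obtain t where "e = {v, t}" using card_2_other E e by metis
        then show ?thesis using E e R(1) 3(2) by (cases "t \<in> R") auto
      next
        case False
        then show ?thesis using R(3)[of e] E e by blast
      qed
    qed
  next
    case 4
    have "subgraph G G" using less.prems(1) unfolding subgraph_def by simp
    then show ?thesis using less.prems(2) 4 by blast
  qed
qed

section \<open>From drawings to arrangements\<close>

text \<open>The Fashoda theorem for four interlaced points on the lower side of a box. That side is
  put on the real axis, and the box is large enough to contain both paths.\<close>

lemma half_plane_paths_meet: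
  fixes f g :: "real \<Rightarrow> complex"
  assumes "path f" "path g" "\<And>z. z \<in> path_image f \<union> path_image g \<Longrightarrow> 0 \<le> Im z"
    and "Im (pathstart f) = 0" "Im (pathfinish f) = 0" "Im (pathstart g) = 0" "Im (pathfinish g) = 0"
    and "Re (pathstart f) < Re (pathstart g)" "Re (pathstart g) < Re (pathfinish f)"
      "Re (pathfinish f) < Re (pathfinish g)"
  shows "path_image f \<inter> path_image g \<noteq> {}"
proof -
  define h :: "complex \<Rightarrow> real^2" where "h z = (\<chi> i. if i = 1 then Re z else Im z)" for z
  have h: "h z $ 1 = Re z" "h z $ 2 = Im z" for z unfolding h_def by simp_all
  have cont: "continuous_on S h" for S
    unfolding h_def
  proof (rule continuous_on_vec_lambda)
    show "continuous_on S (\<lambda>z. if i = 1 then Re z else Im z)" for i :: 2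
      by (cases "i = 1") (auto intro!: continuous_intros)
  qed
  have "bounded (path_image f \<union> path_image g)"
    using assms(1,2) by (simp add: bounded_path_image)
  then obtain M where M: "\<And>z. z \<in> path_image f \<union> path_image g \<Longrightarrow> norm z \<le> M"
    unfolding bounded_iff by blast
  let ?a = "vector [- M, 0] :: real^2" and ?b = "vector [M, M] :: real^2"
  have box: "h z \<in> cbox ?a ?b" if "z \<in> path_image f \<union> path_image g" for z
    using M[OF that] assms(3)[OF that] abs_Re_le_cmod[of z] abs_Im_le_cmod[of z]
    by (auto simp: mem_box_cart forall_2 h)
  obtain y where "y \<in> path_image (h \<circ> f)" "y \<in> path_image (h \<circ> g)"
  proof (rule fashoda_interlace[of "h \<circ> f" "h \<circ> g" ?a ?b])
    show "path (h \<circ> f)" "path (h \<circ> g)"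
      using assms(1,2) cont by (auto intro: path_continuous_image)
    show "path_image (h \<circ> f) \<subseteq> cbox ?a ?b" "path_image (h \<circ> g) \<subseteq> cbox ?a ?b"
      using box by (auto simp: path_image_compose)
  qed (use assms(4-) in \<open>simp_all add: pathstart_compose pathfinish_compose h\<close>)
  then obtain z w where "z \<in> path_image f" "w \<in> path_image g" "h z = h w"
    unfolding path_image_compose by auto
  moreover from this have "z = w" using h[of z] h[of w] by (simp add: complex_eq_iff)
  ultimately show ?thesis by blast
qed

text \<open>The Cayley transform: it takes the closed unit disk without \<open>- 1\<close> into the
  closed upper half plane and the circle into the real line. So \<open>Re (cayley w)\<close> orders
  the circle cut open at \<open>- 1\<close>.\<close>

definition cayley :: "complex \<Rightarrow> complex" where
  "cayley w = \<i> * ((1 - w) / (1 + w))"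

lemma cayley_inj: "w \<noteq> - 1 \<Longrightarrow> w' \<noteq> - 1 \<Longrightarrow> cayley w = cayley w' \<Longrightarrow> w = w'"
proof -
  assume a: "w \<noteq> - 1" "w' \<noteq> - 1" "cayley w = cayley w'"
  then have "1 + w \<noteq> 0" "1 + w' \<noteq> 0" by (metis add.commute eq_neg_iff_add_eq_0)+
  then have "(1 - w) * (1 + w') = (1 - w') * (1 + w)"
    using a(3) unfolding cayley_def by (simp add: frac_eq_eq)
  then show "w = w'" by (simp add: algebra_simps)
qed

lemma Im_cayley: "Im (cayley w) = (1 - (norm w)\<^sup>2) / (norm (1 + w))\<^sup>2"
proof -
  have "(1 - w) / (1 + w) = (1 - w) * cnj (1 + w) / of_real ((norm (1 + w))\<^sup>2)"
    by (rule complex_div_cnj)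
  then have "Im (cayley w) = Re ((1 - w) * cnj (1 + w)) / (norm (1 + w))\<^sup>2"
    unfolding cayley_def by simp
  moreover have "Re ((1 - w) * cnj (1 + w)) = 1 - (norm w)\<^sup>2"
    unfolding cmod_power2 by (simp add: power2_eq_square algebra_simps)
  ultimately show ?thesis by simp
qed

lemma disk_paths_meet:
  fixes f g :: "real \<Rightarrow> complex"
  assumes "path f" "path g" "path_image f \<subseteq> cball 0 1" "path_image g \<subseteq> cball 0 1"
    and norm: "norm (pathstart f) = 1" "norm (pathfinish f) = 1" "norm (pathstart g) = 1" "norm (pathfinish g) = 1"
    and ne: "pathstart f \<noteq> - 1" "pathfinish f \<noteq> - 1" "pathstart g \<noteq> - 1" "pathfinish g \<noteq> - 1"
    and less: "Re (cayley (pathstart f)) < Re (cayley (pathstart g))"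
      "Re (cayley (pathstart g)) < Re (cayley (pathfinish f))"
      "Re (cayley (pathfinish f)) < Re (cayley (pathfinish g))"
  shows "path_image f \<inter> path_image g \<noteq> {}"
proof -
  \<comment> \<open>The paths may touch \<open>-1\<close>, the pole of \<open>cayley\<close>. So they are shrunk to half their size and
    joined to their former ends by radial segments.\<close>
  define ext where "ext f = linepath (pathstart f) (pathstart f / 2) +++ ((\<lambda>z. z / 2) \<circ> f) +++
      linepath (pathfinish f / 2) (pathfinish f)" for f :: "real \<Rightarrow> complex"
  have seg: "\<exists>s. 1/2 \<le> s \<and> s \<le> 1 \<and> w = of_real s * u" if w: "w \<in> closed_segment u (u / 2)" for u w :: complex
  proof -
    obtain s where s: "0 \<le> s" "s \<le> 1" "w = (1 - s) *\<^sub>R u + s *\<^sub>R (u / 2)"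
      using w unfolding closed_segment_def by blast
    have "w = of_real (1 - s / 2) * u" unfolding s(3) by (simp add: scaleR_conv_of_real algebra_simps)
    then show ?thesis using s(1,2) by (intro exI[of _ "1 - s / 2"]) auto
  qed
  have image: "path_image (ext f) = closed_segment (pathstart f) (pathstart f / 2) \<union> (\<lambda>z. z / 2) ` path_image f \<union>
      closed_segment (pathfinish f) (pathfinish f / 2)" for f
    unfolding ext_def
    by (simp add: path_image_join path_image_compose pathstart_compose pathfinish_compose closed_segment_commute Un_assoc)
  have path: "path (ext f)" if "path f" for f
    unfolding ext_def using that
    by (auto intro!: path_continuous_image continuous_intros simp: pathstart_compose pathfinish_compose)
  have ends: "pathstart (ext f) = pathstart f" "pathfinish (ext f) = pathfinish f" for f
    unfolding ext_def by simp_all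
  have elim: "(\<exists>s u. 1/2 \<le> s \<and> s \<le> 1 \<and> (u = pathstart f \<or> u = pathfinish f) \<and> w = of_real s * u)
      \<or> (\<exists>y\<in>path_image f. w = y / 2)"
    if "w \<in> path_image (ext f)" for w f
    using that seg[of w "pathstart f"] seg[of w "pathfinish f"] unfolding image by blast
  have ball: "norm w \<le> 1 \<and> w \<noteq> - 1"
    if "w \<in> path_image (ext f)" "path_image f \<subseteq> cball 0 1" "norm (pathstart f) = 1" "norm (pathfinish f) = 1"
      "pathstart f \<noteq> - 1" "pathfinish f \<noteq> - 1" for w f
  proof -
    from elim[OF that(1)] consider (seg) s u where "1/2 \<le> s" "s \<le> 1"
        "u = pathstart f \<or> u = pathfinish f" "w = of_real s * u"
      | (half) y where "y \<in> path_image f" "w = y / 2" by blast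
    then show ?thesis
    proof cases
      case (seg s u)
      note s = seg(1,2) and u = seg(3) and w = seg(4)
    have "norm u = 1" "u \<noteq> - 1" using u that by auto
    then have "norm w = s" using s w by (simp add: norm_mult)
    moreover have "w \<noteq> - 1"
    proof
      assume "w = - 1"
      then have "s = 1" using \<open>norm w = s\<close> by simp
      then show False using w \<open>w = - 1\<close> \<open>u \<noteq> - 1\<close> by simp
    qed
    ultimately show ?thesis using s by simp
    next
      case (half y)
      then have "norm w \<le> 1/2" using that(2) by (auto simp: norm_divide)
      then show ?thesis by auto
    qed
  qed
  note ballf = ball[OF _ assms(3) norm(1,2) ne(1,2)] and ballg = ball[OF _ assms(4) norm(3,4) ne(3,4)]
  have cont: "continuous_on S cayley" if "\<And>w. w \<in> S \<Longrightarrow> w \<noteq> - 1" for S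
  proof -
    have "1 + w \<noteq> 0" if "w \<in> S" for w
      using \<open>\<And>w. w \<in> S \<Longrightarrow> w \<noteq> - 1\<close>[OF that] by (metis add.commute eq_neg_iff_add_eq_0)
    then show ?thesis unfolding cayley_def by (intro continuous_intros) auto
  qed
  have "path_image (cayley \<circ> ext f) \<inter> path_image (cayley \<circ> ext g) \<noteq> {}"
  proof (rule half_plane_paths_meet)
    show "path (cayley \<circ> ext f)" "path (cayley \<circ> ext g)"
      using path assms(1,2) ballf ballg by (auto intro!: path_continuous_image cont)
    fix z assume "z \<in> path_image (cayley \<circ> ext f) \<union> path_image (cayley \<circ> ext g)"
    then obtain w where w: "z = cayley w" "norm w \<le> 1"
      using ballf ballg unfolding path_image_compose by blast
    then have "(norm w)\<^sup>2 \<le> 1" by (simp add: power_le_one)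
    then show "0 \<le> Im z" unfolding w Im_cayley by simp
  qed (use norm less in \<open>simp_all add: pathstart_compose pathfinish_compose ends Im_cayley\<close>)
  then obtain w w' where "w \<in> path_image (ext f)" "w' \<in> path_image (ext g)" "cayley w = cayley w'"
    unfolding path_image_compose by auto
  then have w: "w \<in> path_image (ext f)" "w \<in> path_image (ext g)"
    using ballf ballg cayley_inj by blast+
  have distinct: "u \<noteq> v" if "u = pathstart f \<or> u = pathfinish f" "v = pathstart g \<or> v = pathfinish g" for u v
    using that less by auto
  \<comment> \<open>Radial segments have norm at least 1/2 and shrunk paths at most 1/2, so they can
    meet only in the half of an end, and then the unshrunk path passes through this end. Two radial
    segments of different ends are disjoint, so every meeting point yields one of the original
    paths.\<close>
  have half: "\<exists>y. y \<in> path_image f \<and> y \<in> path_image g"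
    if "w = of_real s * u" "1/2 \<le> s" "u = pathstart f \<or> u = pathfinish f" "y \<in> path_image g" "w = y / 2"
      "path_image g \<subseteq> cball 0 1" "norm (pathstart f) = 1" "norm (pathfinish f) = 1" for f g s u y
  proof -
    have "norm u = 1" using that by auto
    then have "norm w = s" using that(1,2) by (simp add: norm_mult)
    moreover have "norm w \<le> 1/2" using that(4-6) by (auto simp: norm_divide)
    ultimately have s: "s = 1/2" using that(2) by simp
    have "y = u" using that(1,5) unfolding s by simp
    then show ?thesis using that(3,4) pathstart_in_path_image pathfinish_in_path_image by metis
  qed
  have "\<exists>y. y \<in> path_image f \<and> y \<in> path_image g"
  proof -
    from elim[OF w(1)] consider (seg) s u where "1/2 \<le> s" "s \<le> 1"
        "u = pathstart f \<or> u = pathfinish f" "w = of_real s * u"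
      | (half) y where "y \<in> path_image f" "w = y / 2" by blast
    then show ?thesis
    proof cases
      case f: (seg s u)
      from elim[OF w(2)] consider (seg) s' u' where "1/2 \<le> s'" "s' \<le> 1"
          "u' = pathstart g \<or> u' = pathfinish g" "w = of_real s' * u'"
        | (half) y' where "y' \<in> path_image g" "w = y' / 2" by blast
      then show ?thesis
      proof cases
        case g: (seg s' u')
        have "norm u = 1" "norm u' = 1" using f(3) g(3) norm by auto
        moreover have "norm w = s" using calculation(1) f(1) unfolding f(4) by (simp add: norm_mult)
        moreover have "norm w = s'" using calculation(2) g(1) unfolding g(4) by (simp add: norm_mult)
        ultimately have "s = s'" by simp
        then have "of_real s * u = of_real s * u'" "s \<noteq> 0" using f(1,4) g(4) by auto
        then have "u = u'" by simp
        then show ?thesis using distinct[OF f(3) g(3)] by simp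
      next
        case g: (half y')
        then show ?thesis using half[OF f(4,1,3) g assms(4) norm(1,2)] by blast
      qed
    next
      case f: (half y)
      from elim[OF w(2)] consider (seg) s' u' where "1/2 \<le> s'" "s' \<le> 1"
          "u' = pathstart g \<or> u' = pathfinish g" "w = of_real s' * u'"
        | (half) y' where "y' \<in> path_image g" "w = y' / 2" by blast
      then show ?thesis
      proof cases
        case g: (seg s' u')
        then show ?thesis using half[OF g(4,1,3) f assms(3) norm(3,4)] by blast
      next
        case g: (half y')
        then show ?thesis using f by auto
      qed
    qed
  qed
  then show ?thesis by blast
qed

text \<open>Interleaving edges have disjoint ends, and an arc contains no vertices but its ends, so
  a common point of their arcs is a crossing. Hence the interleaving partners of an edge are among
  those that cross it in the drawing.\<close>

lemma disk_drawing_one_crossing: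
  assumes "simple_graph B" "disk_drawing B c r p \<gamma>"
    and one: "\<forall>e\<in>edges B. card {f \<in> edges B. crosses B p \<gamma> e f} \<le> 1"
  shows "\<exists>t. one_crossing t (edges B)"
proof -
  define V where "V = verts B"
  define E where "E = edges B"
  have finV: "finite V" and E: "\<And>e. e \<in> E \<Longrightarrow> e \<subseteq> V"
    using assms(1) unfolding simple_graph_def V_def E_def by auto
  have finE: "finite E" by (rule finite_subset[of _ "Pow V"]) (use E finV in auto)
  have r: "0 < r" and injp: "inj_on p V" and sphere: "p ` V \<subseteq> sphere c r"
    using assms(2) unfolding disk_drawing_def V_def by auto
  have all: "\<forall>e\<in>E. arc (\<gamma> e) \<and> {pathstart (\<gamma> e), pathfinish (\<gamma> e)} = p ` e \<and>
      path_image (\<gamma> e) \<subseteq> cball c r \<and> path_image (\<gamma> e) \<inter> p ` V = p ` e"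
    using assms(2) unfolding disk_drawing_def V_def E_def by (elim conjE)
  have arc: "arc (\<gamma> e)" "{pathstart (\<gamma> e), pathfinish (\<gamma> e)} = p ` e" "path_image (\<gamma> e) \<subseteq> cball c r"
    "path_image (\<gamma> e) \<inter> p ` V = p ` e" if "e \<in> E" for e
    using bspec[OF all that] by - (elim conjE, assumption)+
  have "infinite (sphere c r)"
  proof
    assume "finite (sphere c r)"
    moreover have "connected (sphere c r)" by (rule connected_sphere) simp
    ultimately consider "sphere c r = {}" | a where "sphere c r = {a}"
      using connected_finite_iff_sing by metis
    moreover have "c + of_real r \<in> sphere c r" "c - of_real r \<in> sphere c r" using r by (auto simp: dist_norm)
    ultimately show False using r by cases auto
  qed
  then obtain s where s: "s \<in> sphere c r" "s \<notin> p ` V"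
    using finV by (meson finite_imageI finite_subset subsetI)
  \<comment> \<open>Dividing by \<open>c - s\<close> scales the circle to the unit circle and sends
    the free point \<open>s\<close> to \<open>- 1\<close>, the pole of
    \<open>cayley\<close>.\<close>
  define k where "k = c - s"
  have k: "norm k = r" "k \<noteq> 0" using s(1) r unfolding k_def by (auto simp: dist_norm)
  define m where "m z = (z - c) / k" for z
  have m_norm: "norm (m (p v)) = 1" if "v \<in> V" for v
    using sphere that k r unfolding m_def by (auto simp: norm_divide dist_norm norm_minus_commute image_subset_iff)
  have m_ne: "m (p v) \<noteq> - 1" if "v \<in> V" for v
  proof
    assume "m (p v) = - 1"
    then have "p v = s" using k(2) unfolding m_def k_def by (simp add: field_simps)
    then show False using s(2) that by blast
  qed
  have m_inj: "m x = m y \<longleftrightarrow> x = y" for x y using k(2) unfolding m_def by simp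
  define t where "t v = Re (cayley (m (p v)))" for v
  have "inj_on t V"
  proof (rule inj_onI)
    fix u v assume uv: "u \<in> V" "v \<in> V" "t u = t v"
    then have "cayley (m (p u)) = cayley (m (p v))"
      using m_norm unfolding t_def by (simp add: complex_eq_iff Im_cayley)
    then have "p u = p v" using cayley_inj m_ne m_inj uv by blast
    then show "u = v" using injp uv by (auto dest: inj_onD)
  qed
  then have inj: "inj_on t (\<Union>E)" by (rule inj_on_subset) (use E in auto)
  have meet: "path_image (\<gamma> {a, c}) \<inter> path_image (\<gamma> {b, d}) \<noteq> {}"
    if less: "t a < t b" "t b < t c" "t c < t d" and acbd: "{a, c} \<in> E" "{b, d} \<in> E" for a b c d
  proof -
    \<comment> \<open>A drawing fixes the ends of an arc only as a set, so the arc may have to be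
      reversed.\<close>
    have orient: "\<exists>h. path h \<and> pathstart h = m (p u) \<and> pathfinish h = m (p v) \<and>
        path_image h = m ` path_image (\<gamma> {u, v})" if uv: "{u, v} \<in> E" for u v
    proof -
      have "{pathstart (\<gamma> {u, v}), pathfinish (\<gamma> {u, v})} = {p u, p v}" using arc(2)[OF uv] by simp
      then consider "pathstart (\<gamma> {u, v}) = p u" "pathfinish (\<gamma> {u, v}) = p v"
        | "pathstart (\<gamma> {u, v}) = p v" "pathfinish (\<gamma> {u, v}) = p u"
        by (auto simp: doubleton_eq_iff)
      then obtain h where h: "path h" "pathstart h = p u" "pathfinish h = p v" "path_image h = path_image (\<gamma> {u, v})"
        using arc(1)[OF uv] arc_imp_path path_reversepath pathstart_reversepath pathfinish_reversepath
          path_image_reversepath by metis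
      have "path (m \<circ> h)" using h(1) unfolding m_def by (intro path_continuous_image continuous_intros) (use k in auto)
      then show ?thesis using h by (intro exI[of _ "m \<circ> h"]) (simp add: pathstart_compose pathfinish_compose path_image_compose)
    qed
    obtain f where f: "path f" "pathstart f = m (p a)" "pathfinish f = m (p c)" "path_image f = m ` path_image (\<gamma> {a, c})"
      using orient[OF acbd(1)] by blast
    obtain g where g: "path g" "pathstart g = m (p b)" "pathfinish g = m (p d)" "path_image g = m ` path_image (\<gamma> {b, d})"
      using orient[OF acbd(2)] by blast
    have V: "a \<in> V" "b \<in> V" "c \<in> V" "d \<in> V" using E acbd by blast+
    have ball: "m ` path_image (\<gamma> e) \<subseteq> cball 0 1" if "e \<in> E" for e
      using arc(3)[OF that] k r unfolding m_def by (auto simp: norm_divide dist_norm norm_minus_commute)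
    have "path_image f \<inter> path_image g \<noteq> {}"
    proof (rule disk_paths_meet[OF f(1) g(1)])
      show "path_image f \<subseteq> cball 0 1" "path_image g \<subseteq> cball 0 1"
        unfolding f(4) g(4) using ball acbd by blast+
    qed (unfold f(2,3) g(2,3), use m_norm m_ne V less in \<open>auto simp: t_def\<close>)
    then show ?thesis unfolding f(4) g(4) using m_inj by auto
  qed
  have cross: "crosses B p \<gamma> {a, c} {b, d} \<and> crosses B p \<gamma> {b, d} {a, c}"
    if less: "t a < t b" "t b < t c" "t c < t d" and acbd: "{a, c} \<in> E" "{b, d} \<in> E" for a b c d
  proof -
    have V: "a \<in> V" "b \<in> V" "c \<in> V" "d \<in> V" using E acbd by blast+
    obtain x where x: "x \<in> path_image (\<gamma> {a, c})" "x \<in> path_image (\<gamma> {b, d})"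
      using meet[OF less acbd] by blast
    have disj: "{a, c} \<inter> {b, d} = {}" using less by auto
    then have "p ` {a, c} \<inter> p ` {b, d} = {}"
      using inj_on_image_Int[OF injp, of "{a, c}" "{b, d}"] V by simp
    then have "x \<notin> p ` V" using x arc(4)[OF acbd(1)] arc(4)[OF acbd(2)] by blast
    then show ?thesis using x disj unfolding crosses_def V_def by blast
  qed
  have cross': "crosses B p \<gamma> e f" if "e \<in> E" "f \<in> E" "pos_crosses t e f" for e f
    using that cross unfolding pos_crosses_def by blast
  have "f = g" if "e \<in> E" "f \<in> E" "g \<in> E" "pos_crosses t e f" "pos_crosses t e g" for e f g
  proof -
    have "card {f \<in> E. crosses B p \<gamma> e f} \<le> Suc 0" using one that(1) unfolding E_def by simp
    then have "\<forall>x\<in>{f \<in> E. crosses B p \<gamma> e f}. \<forall>y\<in>{f \<in> E. crosses B p \<gamma> e f}. x = y"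
      using finE by (subst (asm) card_le_Suc0_iff_eq) auto
    moreover have "f \<in> {f \<in> E. crosses B p \<gamma> e f}" "g \<in> {f \<in> E. crosses B p \<gamma> e f}"
      using that cross' by auto
    ultimately show ?thesis by blast
  qed
  then have "one_crossing t E" using inj unfolding one_crossing_def by blast
  then show ?thesis unfolding E_def by blast
qed

section \<open>Linear arboricity\<close>

lemma path_forest_card_2: "path_forest F \<Longrightarrow> e \<in> F \<Longrightarrow> card e = 2"
  by (induction rule: path_forest.induct) auto

text \<open>A cycle through the new vertex \<open>u\<close> would have \<open>v\<close> on both
  sides of it, but the two neighbours of a vertex on a cycle differ. A cycle that avoids
  \<open>u\<close> already lies in \<open>F\<close>.\<close>

lemma path_forest_acyclic: "path_forest F \<Longrightarrow> \<not> is_cycle (V, F) xs"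
proof (induction rule: path_forest.induct)
  case empty
  show ?case unfolding is_cycle_def by (auto intro!: exI[of _ 0])
next
  case (attach F u v)
  show ?case
  proof
    assume cyc: "is_cycle (V, insert {u, v} F) xs"
    let ?n = "length xs"
    have n: "3 \<le> ?n" "distinct xs" and e: "\<And>i. i < ?n \<Longrightarrow> {xs ! i, xs ! (Suc i mod ?n)} \<in> insert {u, v} F"
      using cyc unfolding is_cycle_def by auto
    have "u \<in> set xs"
    proof (rule ccontr)
      assume u: "u \<notin> set xs"
      have "{xs ! i, xs ! (Suc i mod ?n)} \<in> F" if "i < ?n" for i
      proof -
        have "Suc i mod ?n < ?n" using n(1) by (intro mod_less_divisor) linarith
        then have "xs ! i \<noteq> u" "xs ! (Suc i mod ?n) \<noteq> u" using u that nth_mem by metis+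
        then have "{xs ! i, xs ! (Suc i mod ?n)} \<noteq> {u, v}" by (auto simp: doubleton_eq_iff)
        then show ?thesis using e[OF that] by simp
      qed
      then have "is_cycle (V, F) xs" using cyc unfolding is_cycle_def by auto
      then show False using attach.IH by simp
    qed
    then obtain i where i: "i < ?n" "xs ! i = u" by (auto simp: in_set_conv_nth)
    define j where "j = (if i = 0 then ?n - 1 else i - 1)"
    have j: "j < ?n" "Suc j mod ?n = i" using i n(1) unfolding j_def by auto
    have only: "w = v" if "{u, w} \<in> insert {u, v} F" for w
      using that attach.hyps(2,3) by (auto simp: doubleton_eq_iff)
    have "xs ! (Suc i mod ?n) = v" using only e[OF i(1)] i(2) by simp
    moreover have "xs ! j = v" using only e[OF j(1)] i(2) j(2) by (simp add: insert_commute)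
    moreover have "Suc i mod ?n < ?n" using n(1) by (intro mod_less_divisor) linarith
    ultimately have "Suc i mod ?n = j" using n(2) j(1) nth_eq_iff_index_eq by metis
    moreover have "Suc i mod ?n = (if Suc i = ?n then 0 else Suc i)" using i(1) by auto
    ultimately show False using n(1) i(1) unfolding j_def by (auto split: if_splits)
  qed
qed

definition path_edges :: "'a list \<Rightarrow> 'a set set" where
  "path_edges xs = {{xs ! i, xs ! Suc i} | i. Suc i < length xs}"

lemma finite_path_edges: "finite (path_edges xs)"
proof -
  have "path_edges xs \<subseteq> (\<lambda>i. {xs ! i, xs ! Suc i}) ` {..<length xs}" unfolding path_edges_def by auto
  then show ?thesis by (rule finite_subset) simp
qed

lemma path_edges_Cons:
  assumes "xs \<noteq> []"
  shows "path_edges (u # xs) = insert {u, xs ! 0} (path_edges xs)"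
proof (rule set_eqI)
  fix e
  have "e \<in> path_edges (u # xs) \<longleftrightarrow> (\<exists>i<length xs. e = {(u # xs) ! i, xs ! i})"
    unfolding path_edges_def by auto
  also have "\<dots> \<longleftrightarrow> e = {u, xs ! 0} \<or> (\<exists>i. Suc i < length xs \<and> e = {xs ! i, xs ! Suc i})"
  proof
    assume "\<exists>i<length xs. e = {(u # xs) ! i, xs ! i}"
    then obtain i where "i < length xs" "e = {(u # xs) ! i, xs ! i}" by blast
    then show "e = {u, xs ! 0} \<or> (\<exists>i. Suc i < length xs \<and> e = {xs ! i, xs ! Suc i})" by (cases i) auto
  next
    assume "e = {u, xs ! 0} \<or> (\<exists>i. Suc i < length xs \<and> e = {xs ! i, xs ! Suc i})"
    then show "\<exists>i<length xs. e = {(u # xs) ! i, xs ! i}"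
    proof
      assume "e = {u, xs ! 0}"
      then show ?thesis using assms by (intro exI[of _ 0]) simp
    next
      assume "\<exists>i. Suc i < length xs \<and> e = {xs ! i, xs ! Suc i}"
      then obtain i where "Suc i < length xs" "e = {xs ! i, xs ! Suc i}" by blast
      then show ?thesis by (intro exI[of _ "Suc i"]) simp
    qed
  qed
  finally show "e \<in> path_edges (u # xs) \<longleftrightarrow> e \<in> insert {u, xs ! 0} (path_edges xs)"
    unfolding path_edges_def by auto
qed

lemma path_edges_rev: "path_edges (rev xs) = path_edges xs"
proof -
  have sub: "path_edges xs \<subseteq> path_edges (rev xs)" for xs :: "'a list"
  proof
    fix e assume "e \<in> path_edges xs"
    then obtain i where i: "Suc i < length xs" "e = {xs ! i, xs ! Suc i}" unfolding path_edges_def by blast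
    define j where "j = length xs - Suc (Suc i)"
    have j: "Suc j < length (rev xs)" using i(1) unfolding j_def by simp
    have "length xs - Suc j = Suc i" "length xs - Suc (Suc j) = i" using i(1) unfolding j_def by simp_all
    then have "rev xs ! j = xs ! Suc i" "rev xs ! Suc j = xs ! i" using j by (simp_all add: rev_nth)
    then have "e = {rev xs ! j, rev xs ! Suc j}" using i(2) by (simp add: insert_commute)
    then show "e \<in> path_edges (rev xs)" using j unfolding path_edges_def by blast
  qed
  show ?thesis using sub[of xs] sub[of "rev xs"] by auto
qed

lemma path_graph_iff:
  "path_graph G \<longleftrightarrow> (\<exists>xs. xs \<noteq> [] \<and> distinct xs \<and> verts G = set xs \<and> edges G = path_edges xs)"
  unfolding path_graph_def path_edges_def ..

text \<open>A vertex of degree at most one on a path is an end of it; after a reversal if necessary,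
  \<open>u\<close> is put in front.\<close>

lemma path_graph_attach:
  assumes "path_graph (W, D)" "v \<in> W" "u \<notin> W" "deg D v \<le> 1"
  shows "path_graph (insert u W, insert {u, v} D)"
proof -
  obtain xs where xs: "xs \<noteq> []" "distinct xs" "W = set xs" "D = path_edges xs"
    using assms(1) unfolding path_graph_iff by auto
  obtain i where i: "i < length xs" "xs ! i = v" using assms(2) xs(3) by (auto simp: in_set_conv_nth)
  have "i = 0 \<or> Suc i = length xs"
  proof (rule ccontr)
    assume "\<not> (i = 0 \<or> Suc i = length xs)"
    then obtain j where j: "i = Suc j" "Suc i < length xs" using i(1) by (cases i) auto
    have sub: "{{xs ! j, v}, {v, xs ! Suc i}} \<subseteq> {e \<in> D. v \<in> e}"
      using i j unfolding xs(4) path_edges_def by auto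
    have "xs ! j \<noteq> xs ! Suc i" using xs(2) j by (simp add: nth_eq_iff_index_eq)
    then have "{xs ! j, v} \<noteq> {v, xs ! Suc i}" by (auto simp: doubleton_eq_iff)
    then have "card {{xs ! j, v}, {v, xs ! Suc i}} = 2" by simp
    moreover have "finite D" unfolding xs(4) by (rule finite_path_edges)
    ultimately have "2 \<le> deg D v" using card_mono[OF _ sub] by simp
    then show False using assms(4) by simp
  qed
  then obtain ys where ys: "ys \<noteq> []" "distinct ys" "W = set ys" "D = path_edges ys" "ys ! 0 = v"
  proof
    assume "i = 0"
    then show thesis using that[of xs] xs i by simp
  next
    assume "Suc i = length xs"
    then have "length xs - 1 = i" by simp
    then have "rev xs ! 0 = v" using xs(1) i(2) by (simp add: rev_nth)
    then show thesis using that[of "rev xs"] xs by (simp add: path_edges_rev)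
  qed
  then have "path_edges (u # ys) = insert {u, v} D" by (simp add: path_edges_Cons)
  then show ?thesis using ys assms(3) unfolding path_graph_iff by (intro exI[of _ "u # ys"]) simp
qed

text \<open>The claim covers all connected subgraphs, not just components, so that the induction
  hypothesis applies to what remains after the leaf \<open>u\<close> is removed.\<close>

lemma path_forest_connected_path_graph:
  "path_forest F \<Longrightarrow> simple_graph (W, D) \<Longrightarrow> connected_graph (W, D) \<Longrightarrow> D \<subseteq> F \<Longrightarrow> path_graph (W, D)"
proof (induction arbitrary: W D rule: path_forest.induct)
  case empty
  then have "D = {}" by simp
  then have "(adjacency (W, D))\<^sup>* = Id" unfolding adjacency_def by auto
  then obtain x where "W = {x}" using empty.prems(2) unfolding connected_graph_def by auto
  then show ?case using \<open>D = {}\<close> unfolding path_graph_def by (intro exI[of _ "[x]"]) auto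
next
  case (attach F u v)
  show ?case
  proof (cases "{u, v} \<in> D")
    case False
    then have "D \<subseteq> F" using attach.prems(3) by blast
    then show ?thesis by (rule attach.IH[OF attach.prems(1,2)])
  next
    case True
    let ?W = "W - {u}" and ?D = "D - {{u, v}}"
    have D: "e \<subseteq> W \<and> card e = 2" if "e \<in> D" for e using attach.prems(1) that unfolding simple_graph_def by auto
    have finW: "finite W" using attach.prems(1) unfolding simple_graph_def by simp
    have vW: "v \<in> W" "u \<in> W" using D[OF True] by auto
    have D': "?D \<subseteq> F" using attach.prems(3) by blast
    have u_notin: "u \<notin> e" if "e \<in> ?D" for e using that D' attach.hyps(3) by blast
    have only: "w = v" if "{u, w} \<in> D" for w
    proof -
      have "{u, w} = {u, v}" using u_notin[of "{u, w}"] that by blast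
      then show ?thesis by (auto simp: doubleton_eq_iff)
    qed
    \<comment> \<open>A walk avoids \<open>u\<close> after every visit to it is replaced by one to
      \<open>v\<close>, its only neighbour; the steps between \<open>u\<close> and \<open>v\<close>
      become trivial.\<close>
    have conn: "(x, if y = u then v else y) \<in> (adjacency (?W, ?D))\<^sup>*"
      if "(x, y) \<in> (adjacency (W, D))\<^sup>*" "x \<noteq> u" for x y
      using that(1)
    proof (induction rule: rtrancl_induct)
      case base
      then show ?case using that(2) by simp
    next
      case (step y z)
      have yz: "{y, z} \<in> D" using step.hyps(2) unfolding adjacency_def by simp
      consider "y = u" | "z = u" | "y \<noteq> u" "z \<noteq> u" by blast
      then show ?case
      proof cases
        case 1
        then have "z = v" using only yz by simp
        then show ?thesis using step.IH 1 attach.hyps(2) by simp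
      next
        case 2
        then have "y = v" using only yz by (simp add: insert_commute)
        then show ?thesis using step.IH 2 attach.hyps(2) by simp
      next
        case 3
        then have "{y, z} \<in> ?D" using yz by (auto simp: doubleton_eq_iff)
        then have "(y, z) \<in> adjacency (?W, ?D)" unfolding adjacency_def by simp
        then show ?thesis using step.IH 3 by (simp add: rtrancl_into_rtrancl)
      qed
    qed
    have "path_graph (?W, ?D)"
    proof (rule attach.IH)
      show "simple_graph (?W, ?D)" using D u_notin finW unfolding simple_graph_def by fastforce
      have "(x, y) \<in> (adjacency (?W, ?D))\<^sup>*" if "x \<in> ?W" "y \<in> ?W" for x y
        using conn[of x y] that attach.prems(2) unfolding connected_graph_def by auto
      then show "connected_graph (?W, ?D)"
        using vW(1) attach.hyps(2) unfolding connected_graph_def by auto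
    qed (rule D')
    moreover have "deg ?D v \<le> deg F v"
      using D' path_forest_finite[OF attach.hyps(1)] by (intro card_mono) auto
    ultimately have "path_graph (insert u ?W, insert {u, v} ?D)"
      using vW(1) attach.hyps(2,4) by (intro path_graph_attach) auto
    moreover have "insert u ?W = W" "insert {u, v} ?D = D" using vW True by auto
    ultimately show ?thesis by simp
  qed
qed

lemma path_forest_linear_forest:
  assumes "path_forest F"
  shows "linear_forest (\<Union>F, F)"
proof -
  have "finite e" if "e \<in> F" for e using path_forest_card_2[OF assms that] by (metis card.infinite zero_neq_numeral)
  then have "simple_graph (\<Union>F, F)"
    using path_forest_card_2[OF assms] path_forest_finite[OF assms] unfolding simple_graph_def by auto
  then have "forest (\<Union>F, F)" unfolding forest_def using path_forest_acyclic[OF assms] by blast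
  moreover have "path_graph C" if "maximal_subgraph connected_graph C (\<Union>F, F)" for C
    using path_forest_connected_path_graph[OF assms, of "verts C" "edges C"] that
    unfolding maximal_subgraph_def subgraph_def by simp
  ultimately show ?thesis unfolding linear_forest_def by blast
qed

section \<open>The lower bound and the value of the linear arboricity\<close>

lemma path_edges_deg:
  assumes "distinct xs"
  shows "deg (path_edges xs) v \<le> 2"
proof (cases "v \<in> set xs")
  case True
  then obtain i where i: "i < length xs" "xs ! i = v" by (auto simp: in_set_conv_nth)
  have "{e \<in> path_edges xs. v \<in> e} \<subseteq> {{xs ! (i - 1), v}, {v, xs ! Suc i}}"
  proof
    fix e assume "e \<in> {e \<in> path_edges xs. v \<in> e}"
    then obtain j where j: "Suc j < length xs" "e = {xs ! j, xs ! Suc j}" "v \<in> e"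
      unfolding path_edges_def by blast
    then have "j = i \<or> Suc j = i" using i assms by (auto simp: nth_eq_iff_index_eq)
    then show "e \<in> {{xs ! (i - 1), v}, {v, xs ! Suc i}}" using i j by auto
  qed
  then have "deg (path_edges xs) v \<le> card {{xs ! (i - 1), v}, {v, xs ! Suc i}}" by (intro card_mono) auto
  also have "\<dots> \<le> 2" by (simp add: card_insert_if)
  finally show ?thesis .
next
  case False
  then have ne: "xs ! i \<noteq> v" if "i < length xs" for i using that nth_mem by metis
  have "v \<notin> e" if e: "e \<in> path_edges xs" for e
  proof -
    obtain i where i: "Suc i < length xs" "e = {xs ! i, xs ! Suc i}"
      using e unfolding path_edges_def by blast
    then show ?thesis using ne[of i] ne[of "Suc i"] by auto
  qed
  then have "{e \<in> path_edges xs. v \<in> e} = {}" by blast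
  then have "deg (path_edges xs) v = 0" by (simp only: card.empty)
  then show ?thesis by simp
qed

text \<open>The edges at \<open>v\<close> form a star, which is connected and so lies in a
  component, and this component is a path.\<close>

lemma linear_forest_deg:
  assumes "linear_forest (\<Union>F, F)"
  shows "deg F v \<le> 2"
proof (cases "v \<in> \<Union>F")
  case True
  let ?D = "{e \<in> F. v \<in> e}"
  let ?H = "(\<Union>?D, ?D)"
  have simple: "simple_graph (\<Union>F, F)" using assms unfolding linear_forest_def forest_def by blast
  then have "simple_graph ?H" unfolding simple_graph_def by (auto intro: finite_subset[of "\<Union>?D" "\<Union>F"])
  then have sub: "subgraph ?H (\<Union>F, F)" unfolding subgraph_def by auto
  have adj: "(v, x) \<in> (adjacency ?H)\<^sup>* \<and> (x, v) \<in> (adjacency ?H)\<^sup>*" if x: "x \<in> \<Union>?D" for x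
  proof -
    obtain e where e: "e \<in> F" "v \<in> e" "x \<in> e" using x by blast
    have "card e = 2" using simple e(1) unfolding simple_graph_def by auto
    then have "x = v \<or> e = {v, x}" using card_2_other[of e v] e by auto
    then show ?thesis
    proof
      assume "e = {v, x}"
      then have "(v, x) \<in> adjacency ?H" "(x, v) \<in> adjacency ?H"
        using e unfolding adjacency_def by (auto simp: insert_commute)
      then show ?thesis by blast
    qed simp
  qed
  have "connected_graph ?H"
    unfolding connected_graph_def using True adj by (auto intro: rtrancl_trans)
  then obtain K where K: "maximal_subgraph connected_graph K (\<Union>F, F)" "subgraph ?H K"
    by (rule maximal_subgraph_exists[where P = connected_graph, OF simple sub]) blast
  then have "path_graph K" using assms unfolding linear_forest_def by blast
  then obtain xs where xs: "distinct xs" "edges K = path_edges xs" unfolding path_graph_iff by blast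
  have "?D \<subseteq> {e \<in> path_edges xs. v \<in> e}" using K(2) xs(2) unfolding subgraph_def by auto
  moreover have "finite (path_edges xs)" by (rule finite_path_edges)
  ultimately have "deg F v \<le> deg (path_edges xs) v" by (intro card_mono) auto
  then show ?thesis using path_edges_deg[OF xs(1), of v] by simp
next
  case False
  then have "{e \<in> F. v \<in> e} = {}" by blast
  then have "deg F v = 0" by (simp only: card.empty)
  then show ?thesis by simp
qed

text \<open>Every linear forest has at most two edges at \<open>v\<close>, so covering at least
  \<open>2 * k - 1\<close> edges there takes \<open>k\<close> of them.\<close>

lemma linear_arboricity_eqI:
  assumes "finite E" "linear_colorable k E" "2 * k \<le> deg E v + 1"
  shows "linear_arboricity (V, E) = k"
proof -
  have lower: "k \<le> card P" if P: "partition_on E P" "\<forall>F\<in>P. linear_forest (\<Union>F, F)" for P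
  proof -
    have "finite P" using P(1) assms(1) finite_elements by blast
    have "{e \<in> E. v \<in> e} = (\<Union>F\<in>P. {e \<in> F. v \<in> e})" using partition_onD1[OF P(1)] by blast
    then have "deg E v = card (\<Union>F\<in>P. {e \<in> F. v \<in> e})" by (rule arg_cong)
    also have "\<dots> \<le> (\<Sum>F\<in>P. deg F v)" using \<open>finite P\<close> by (rule card_UN_le)
    also have "\<dots> \<le> (\<Sum>F\<in>P. 2)"
    proof (rule sum_mono)
      fix F assume "F \<in> P"
      then have "linear_forest (\<Union>F, F)" using P(2) by blast
      then show "deg F v \<le> 2" by (rule linear_forest_deg)
    qed
    finally show ?thesis using assms(3) by simp
  qed
  obtain \<phi> where \<phi>: "linear_coloring k E \<phi>" using assms(2) unfolding linear_colorable_def by blast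
  define P where "P = (\<lambda>c. {e \<in> E. \<phi> e = c}) ` {..<k} - {{}}"
  have "partition_on E P"
  proof (rule partition_onI)
    show "\<Union>P = E" using \<phi> unfolding P_def linear_coloring_def by auto
    show "disjnt p q" if "p \<in> P" "q \<in> P" "p \<noteq> q" for p q using that unfolding P_def disjnt_def by auto
  qed (auto simp: P_def)
  moreover have forests: "\<forall>F\<in>P. linear_forest (\<Union>F, F)"
  proof
    fix F assume "F \<in> P"
    then obtain c where "F = {e \<in> E. \<phi> e = c}" unfolding P_def by blast
    moreover have "path_forest {e \<in> E. \<phi> e = c}" using \<phi> unfolding linear_coloring_def by blast
    ultimately show "linear_forest (\<Union>F, F)" using path_forest_linear_forest by simp
  qed
  moreover have "card P = k"
  proof (rule antisym)
    have "card P \<le> card ((\<lambda>c. {e \<in> E. \<phi> e = c}) ` {..<k})" unfolding P_def by (intro card_mono) auto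
    also have "\<dots> \<le> card {..<k}" by (rule card_image_le) simp
    finally show "card P \<le> k" by simp
    show "k \<le> card P" using lower \<open>partition_on E P\<close> forests by blast
  qed
  ultimately show ?thesis
    unfolding linear_arboricity_def using lower by (intro Least_equality) auto
qed

text \<open>Each two-connected subgraph lies in a maximal one, which is a block, and inherits the
  arrangement obtained from the drawing of that block.\<close>

lemma pseudo_outerplanar_one_crossing:
  assumes "simple_graph G" "pseudo_outerplanar G"
  shows "\<exists>p. one_crossing p (edges G)"
proof (rule one_crossing_if_two_connected[OF assms(1)])
  fix H assume "subgraph H G" "two_connected H"
  then obtain K where K: "maximal_subgraph two_connected K G" "subgraph H K"
    by (rule maximal_subgraph_exists[where P = two_connected, OF assms(1)]) blast
  then have "block K G" unfolding block_def by blast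
  then obtain c r p \<gamma> where "disk_drawing K c r p \<gamma>" "\<forall>e\<in>edges K. card {f \<in> edges K. crosses K p \<gamma> e f} \<le> 1"
    using assms(2) unfolding pseudo_outerplanar_def by blast
  moreover have "simple_graph K" using K(1) unfolding maximal_subgraph_def subgraph_def by blast
  ultimately obtain t where "one_crossing t (edges K)" using disk_drawing_one_crossing by blast
  then show "\<exists>p. one_crossing p (edges H)"
    using K(2) one_crossing_subset unfolding subgraph_def by blast
qed

theorem theorem5p5:
  fixes G :: "'a graph"
  assumes "simple_graph G"
    and "pseudo_outerplanar G"
    and "max_degree G = 3 \<or> max_degree G \<ge> 5"
  shows "int (linear_arboricity G) = \<lceil>real (max_degree G) / 2\<rceil>"
proof -
  define \<Delta> where "\<Delta> = max_degree G"
  define k where "k = (\<Delta> + 1) div 2"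
  have finV: "finite (verts G)" and two: "\<And>e. e \<in> edges G \<Longrightarrow> e \<subseteq> verts G \<and> card e = 2"
    using assms(1) unfolding simple_graph_def by auto
  have finE: "finite (edges G)" by (rule finite_subset[of _ "Pow (verts G)"]) (use two finV in auto)
  have le: "deg (edges G) v \<le> \<Delta>" for v
  proof (cases "v \<in> verts G")
    case True
    then have "degree G v \<le> Max (insert 0 (degree G ` verts G))" using finV by (intro Max_ge) auto
    then show ?thesis unfolding \<Delta>_def max_degree_def degree_def .
  next
    case False
    then have "{e \<in> edges G. v \<in> e} = {}" using two by blast
    then have "deg (edges G) v = 0" by (simp only: card.empty)
    then show ?thesis by simp
  qed
  have "Max (insert 0 (degree G ` verts G)) \<in> insert 0 (degree G ` verts G)" using finV by (intro Max_in) auto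
  \<comment> \<open>The maximum is at least three, so it is attained by a vertex and is not the
    inserted 0.\<close>
  then obtain v where v: "deg (edges G) v = \<Delta>"
    using assms(3) unfolding \<Delta>_def max_degree_def degree_def by auto
  obtain p where "one_crossing p (edges G)"
    using pseudo_outerplanar_one_crossing[OF assms(1,2)] by blast
  moreover have "3 \<le> k \<and> (\<forall>v. deg (edges G) v \<le> 2 * k) \<or> k = 2 \<and> (\<forall>v. deg (edges G) v \<le> 3)"
  proof (cases "\<Delta> = 3")
    case True
    then show ?thesis using le unfolding k_def by simp
  next
    case False
    then have "3 \<le> k" using assms(3) unfolding k_def \<Delta>_def by linarith
    moreover have "\<Delta> \<le> 2 * k" unfolding k_def by linarith
    ultimately show ?thesis using le order_trans by blast
  qed
  ultimately have "linear_colorable k (edges G)"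
    using one_crossing_linear_colorable finE two by blast
  moreover have "2 * k \<le> deg (edges G) v + 1" unfolding v k_def by simp
  ultimately have "linear_arboricity (verts G, edges G) = k"
    by (rule linear_arboricity_eqI[OF finE])
  moreover have "\<lceil>real \<Delta> / 2\<rceil> = int k"
    unfolding k_def by (cases "even \<Delta>") (auto elim!: evenE oddE simp: ceiling_eq_iff)
  ultimately show ?thesis unfolding \<Delta>_def by simp
qed

end
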